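(* Suppose $E$ is an analytic equivalence relation on $2^{\mathbb{N}}$ all of whose equivalence classes are uncountable. If $E$ is Borel graphable, then $E$ has the weak Borel pair-coding property.
   Context: $E$ is Borel graphable if there is a Borel graph on $2^{\mathbb{N}}$ whose connectedness relation equals $E$. $\leq_h$ denotes hyperarithmetic reducibility ($u\le_h v$ iff $u$ is $\Delta^1_1(v)$) and $\oplus$ the Turing join. $E$ has the weak Borel pair-coding property if there is an oracle $a\in2^{\mathbb{N}}$ such that for all $x,b\in2^{\mathbb{N}}$ there is $y$ with $x\,E\,y$ and $b\le_h x\oplus y\oplus a$. *)

theory Defs
  imports "HOL-Analysis.Analysis"
begin

type_synonym cantor = "nat \<Rightarrow> bool"

text \<open>Function types carry the product topology and \<^typ>\<open>bool\<close>, \<^typ>\<open>nat\<close> are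
  discrete, so \<^typ>\<open>nat \<Rightarrow> bool\<close> is Cantor space and \<^typ>\<open>nat \<Rightarrow> nat\<close> is Baire space.\<close>

definition analytic_set :: "'a::topological_space set \<Rightarrow> bool" where
  "analytic_set A \<longleftrightarrow>
     A = {} \<or> (\<exists>f :: (nat \<Rightarrow> nat) \<Rightarrow> 'a. continuous_on UNIV f \<and> A = range f)"

definition borel_graph :: "(cantor \<times> cantor) set \<Rightarrow> bool" where
  "borel_graph G \<longleftrightarrow> G \<in> sets borel \<and> sym G \<and> irrefl G"

definition borel_graphable :: "(cantor \<times> cantor) set \<Rightarrow> bool" where
  "borel_graphable E \<longleftrightarrow> (\<exists>G. borel_graph G \<and> G\<^sup>* = E)"

text \<open>Arithmetical formulas of the language of second-order arithmetic: number variables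
  and set variables are indexed by natural numbers, and only number variables are quantified.\<close>

datatype nterm =
    NVar nat
  | NZero
  | NSuc nterm
  | NAdd nterm nterm
  | NMul nterm nterm

datatype arith_fm =
    FEq nterm nterm
  | FLess nterm nterm
  | FMem nterm nat
  | FNeg arith_fm
  | FAnd arith_fm arith_fm
  | FEx nat arith_fm

primrec nterm_val :: "(nat \<Rightarrow> nat) \<Rightarrow> nterm \<Rightarrow> nat" where
  "nterm_val e (NVar i) = e i"
| "nterm_val e NZero = 0"
| "nterm_val e (NSuc t) = Suc (nterm_val e t)"
| "nterm_val e (NAdd s t) = nterm_val e s + nterm_val e t"
| "nterm_val e (NMul s t) = nterm_val e s * nterm_val e t"

primrec arith_sat :: "(nat \<Rightarrow> nat) \<Rightarrow> (nat \<Rightarrow> cantor) \<Rightarrow> arith_fm \<Rightarrow> bool" where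
  "arith_sat e S (FEq s t) \<longleftrightarrow> nterm_val e s = nterm_val e t"
| "arith_sat e S (FLess s t) \<longleftrightarrow> nterm_val e s < nterm_val e t"
| "arith_sat e S (FMem t i) \<longleftrightarrow> S i (nterm_val e t)"
| "arith_sat e S (FNeg \<phi>) \<longleftrightarrow> \<not> arith_sat e S \<phi>"
| "arith_sat e S (FAnd \<phi> \<psi>) \<longleftrightarrow> arith_sat e S \<phi> \<and> arith_sat e S \<psi>"
| "arith_sat e S (FEx i \<phi>) \<longleftrightarrow> (\<exists>n. arith_sat (e(i := n)) S \<phi>)"

text \<open>Truth of \<open>\<phi>(n, v, X)\<close>, where number variable 0 denotes \<open>n\<close> and set variables 0 and 1
  denote \<open>v\<close> and \<open>X\<close>. Any other free variable of \<open>\<phi>\<close> denotes zero or the empty set, so it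
  provides no additional parameter.\<close>

definition arith_holds :: "arith_fm \<Rightarrow> nat \<Rightarrow> cantor \<Rightarrow> cantor \<Rightarrow> bool" where
  "arith_holds \<phi> n v X \<longleftrightarrow>
     arith_sat ((\<lambda>_. 0)(0 := n)) ((\<lambda>_ _. False)(0 := v, 1 := X)) \<phi>"

definition Sigma11_in :: "cantor \<Rightarrow> nat set \<Rightarrow> bool" where
  "Sigma11_in v A \<longleftrightarrow> (\<exists>\<phi>. A = {n. \<exists>X. arith_holds \<phi> n v X})"

definition Pi11_in :: "cantor \<Rightarrow> nat set \<Rightarrow> bool" where
  "Pi11_in v A \<longleftrightarrow> (\<exists>\<phi>. A = {n. \<forall>X. arith_holds \<phi> n v X})"

definition Delta11_in :: "cantor \<Rightarrow> nat set \<Rightarrow> bool" where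
  "Delta11_in v A \<longleftrightarrow> Sigma11_in v A \<and> Pi11_in v A"

definition hyp_le :: "cantor \<Rightarrow> cantor \<Rightarrow> bool" (infix "\<le>\<^sub>h" 50) where
  "u \<le>\<^sub>h v \<longleftrightarrow> Delta11_in v {n. u n}"

definition turing_join :: "cantor \<Rightarrow> cantor \<Rightarrow> cantor" (infixl "\<oplus>" 65) where
  "x \<oplus> y = (\<lambda>n. if even n then x (n div 2) else y (n div 2))"

definition weak_borel_pair_coding :: "(cantor \<times> cantor) set \<Rightarrow> bool" where
  "weak_borel_pair_coding E \<longleftrightarrow>
     (\<exists>a. \<forall>x b. \<exists>y. (x, y) \<in> E \<and> b \<le>\<^sub>h x \<oplus> y \<oplus> a)"

end

theory Submission
  imports Defs "HOL-Library.Sublist"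
begin

text \<open>
  Let \<open>G\<close> be a Borel graph generating \<open>E\<close>. For every \<open>z\<close>, the neighbours of \<open>z\<close> are
  coded injectively by the branches of a tree \<open>T\<^sub>z\<close> on the natural numbers that is arithmetical in
  \<open>z\<close> and an oracle \<open>a\<close>. If \<open>T\<^sub>z\<close> has empty perfect kernel, then the order of the
  Cantor--Bendixson ranks of its nodes is the unique solution of an arithmetical condition, so every
  branch is hyperarithmetic in \<open>z \<oplus> a\<close>. If the kernel \<open>K\<close> is nonempty, then every \<open>b\<close> is
  hyperarithmetic in some branch \<open>h\<close> of \<open>K\<close> together with \<open>T\<^sub>z\<close>: let \<open>h\<close> follow leftmost paths of \<open>K\<close>
  and leave them so rarely that the gaps between the places where it does so bound the search for
  splittings in \<open>K\<close>. This makes \<open>K\<close> the unique solution of an arithmetical fixed-point equation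
  with parameter \<open>h\<close>, and \<open>b\<close> is read off from the positions of these places relative to \<open>K\<close>.

  Since the class of \<open>x\<close> is uncountable, it has an element that is not hyperarithmetic in \<open>x \<oplus> a\<close>.
  On a path in \<open>G\<close> from \<open>x\<close> to it, the last vertex \<open>z\<close> before the first one that is not
  hyperarithmetic in \<open>x \<oplus> a\<close> has a nonempty kernel, and \<open>y\<close> is found among the neighbours of \<open>z\<close>.
\<close>

section \<open>Arithmetical definability\<close>

instance nterm :: countable by countable_datatype
instance arith_fm :: countable by countable_datatype

section \<open>Connectives, numerals, pairing and substitution in arithmetic\<close>

definition FAll :: "nat \<Rightarrow> arith_fm \<Rightarrow> arith_fm" where
  "FAll i \<phi> = FNeg (FEx i (FNeg \<phi>))"
definition FImp :: "arith_fm \<Rightarrow> arith_fm \<Rightarrow> arith_fm" where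
  "FImp \<phi> \<psi> = FNeg (FAnd \<phi> (FNeg \<psi>))"
definition FOr :: "arith_fm \<Rightarrow> arith_fm \<Rightarrow> arith_fm" where
  "FOr \<phi> \<psi> = FNeg (FAnd (FNeg \<phi>) (FNeg \<psi>))"
definition FIff :: "arith_fm \<Rightarrow> arith_fm \<Rightarrow> arith_fm" where
  "FIff \<phi> \<psi> = FAnd (FImp \<phi> \<psi>) (FImp \<psi> \<phi>)"

lemma arith_sat_derived [simp]:
  "arith_sat e S (FAll i \<phi>) \<longleftrightarrow> (\<forall>n. arith_sat (e(i := n)) S \<phi>)"
  "arith_sat e S (FImp \<phi> \<psi>) \<longleftrightarrow> (arith_sat e S \<phi> \<longrightarrow> arith_sat e S \<psi>)"
  "arith_sat e S (FOr \<phi> \<psi>) \<longleftrightarrow> (arith_sat e S \<phi> \<or> arith_sat e S \<psi>)"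
  "arith_sat e S (FIff \<phi> \<psi>) \<longleftrightarrow> (arith_sat e S \<phi> \<longleftrightarrow> arith_sat e S \<psi>)"
  by (auto simp: FAll_def FImp_def FOr_def FIff_def)

primrec nnum :: "nat \<Rightarrow> nterm" where
  "nnum 0 = NZero"
| "nnum (Suc k) = NSuc (nnum k)"

lemma nterm_val_nnum [simp]: "nterm_val e (nnum k) = k"
  by (induction k) auto

text \<open>A polynomial pairing is itself expressible by a term. It is injective but not onto, so a
  set meant as a relation is determined only if it is also required to contain nothing but codes of
  pairs.\<close>

definition pr :: "nat \<Rightarrow> nat \<Rightarrow> nat" where
  "pr x y = (x + y) * (x + y) + x"

definition npr :: "nterm \<Rightarrow> nterm \<Rightarrow> nterm" where
  "npr s t = NAdd (NMul (NAdd s t) (NAdd s t)) s"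

lemma nterm_val_npr [simp]: "nterm_val e (npr s t) = pr (nterm_val e s) (nterm_val e t)"
  by (simp add: npr_def pr_def)

lemma pr_eq_iff [simp]: "pr x y = pr x' y' \<longleftrightarrow> x = x' \<and> y = y'"
proof
  have less: "pr x y < pr x' y'" if "x + y < x' + y'" for x y x' y'
  proof -
    have "pr x y < Suc (x + y) * Suc (x + y)"
      by (simp add: pr_def)
    also have "\<dots> \<le> (x' + y') * (x' + y')"
      using that by (intro mult_le_mono) auto
    finally show ?thesis
      by (simp add: pr_def)
  qed
  assume eq: "pr x y = pr x' y'"
  then have "x + y = x' + y'"
    using less[of x y x' y'] less[of x' y' x y] by linarith
  with eq show "x = x' \<and> y = y'"
    by (simp add: pr_def)
qed simp

text \<open>Lets one set carry several others on arithmetic progressions. Only closed numerals are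
  added around the term, so no number variable is captured.\<close>

primrec fm_subst :: "(nat \<Rightarrow> nat) \<Rightarrow> (nat \<Rightarrow> nat) \<Rightarrow> (nat \<Rightarrow> nat) \<Rightarrow> arith_fm \<Rightarrow> arith_fm" where
  "fm_subst \<sigma> A B (FEq s t) = FEq s t"
| "fm_subst \<sigma> A B (FLess s t) = FLess s t"
| "fm_subst \<sigma> A B (FMem t i) = FMem (NAdd (NMul (nnum (A i)) t) (nnum (B i))) (\<sigma> i)"
| "fm_subst \<sigma> A B (FNeg \<phi>) = FNeg (fm_subst \<sigma> A B \<phi>)"
| "fm_subst \<sigma> A B (FAnd \<phi> \<psi>) = FAnd (fm_subst \<sigma> A B \<phi>) (fm_subst \<sigma> A B \<psi>)"
| "fm_subst \<sigma> A B (FEx i \<phi>) = FEx i (fm_subst \<sigma> A B \<phi>)"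

lemma arith_sat_subst [simp]:
  "arith_sat e S (fm_subst \<sigma> A B \<phi>) \<longleftrightarrow> arith_sat e (\<lambda>i n. S (\<sigma> i) (A i * n + B i)) \<phi>"
  by (induction \<phi> arbitrary: e) auto

definition closed_fm :: "arith_fm \<Rightarrow> bool" where
  "closed_fm \<phi> \<longleftrightarrow> (\<forall>e e' S. arith_sat e S \<phi> \<longleftrightarrow> arith_sat e' S \<phi>)"

lemma closed_fm_FAnd [intro]: "closed_fm \<phi> \<Longrightarrow> closed_fm \<psi> \<Longrightarrow> closed_fm (FAnd \<phi> \<psi>)"
  unfolding closed_fm_def arith_sat.simps by blast

lemma closed_fm_subst [intro]: "closed_fm \<phi> \<Longrightarrow> closed_fm (fm_subst \<sigma> A B \<phi>)"
  unfolding closed_fm_def arith_sat_subst by blast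

abbreviation holds :: "(nat \<Rightarrow> cantor) \<Rightarrow> arith_fm \<Rightarrow> bool" where
  "holds S \<phi> \<equiv> arith_sat (\<lambda>_. 0) S \<phi>"

definition env2 :: "cantor \<Rightarrow> cantor \<Rightarrow> nat \<Rightarrow> cantor" where
  "env2 v X = (\<lambda>_ _. False)(0 := v, 1 := X)"

text \<open>A variant of hyperarithmetic reducibility that is easier to compose: \<open>b\<close> is the even part
  of every solution of a solvable arithmetical condition on \<open>X\<close> with parameter \<open>v\<close>.\<close>

definition hyp :: "cantor \<Rightarrow> cantor \<Rightarrow> bool" where
  "hyp b v \<longleftrightarrow> (\<exists>\<phi>. closed_fm \<phi> \<and> (\<exists>X. holds (env2 v X) \<phi>) \<and>
     (\<forall>X. holds (env2 v X) \<phi> \<longrightarrow> (\<forall>n. b n = X (2 * n))))"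

text \<open>Solutions exist and agree on the even numbers, so "some solution contains 2n" and "every
  solution contains 2n" are a Sigma and a Pi definition of the same set.\<close>

lemma hyp_imp_hyp_le:
  assumes "hyp b v"
  shows "b \<le>\<^sub>h v"
proof -
  obtain \<phi> where cl: "closed_fm \<phi>" and ex: "\<exists>X. holds (env2 v X) \<phi>"
    and un: "\<And>X n. holds (env2 v X) \<phi> \<Longrightarrow> b n = X (2 * n)"
    using assms unfolding hyp_def by blast
  have sat: "arith_holds (FAnd \<phi> \<psi>) n v X \<longleftrightarrow> holds (env2 v X) \<phi> \<and> arith_holds \<psi> n v X"
    "arith_holds (FImp \<phi> \<psi>) n v X \<longleftrightarrow> (holds (env2 v X) \<phi> \<longrightarrow> arith_holds \<psi> n v X)" for \<psi> n X
    using cl unfolding closed_fm_def arith_holds_def env2_def arith_sat.simps arith_sat_derived by blast+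
  define \<psi> where "\<psi> = FMem (NMul (nnum 2) (NVar 0)) 1"
  have \<psi>: "arith_holds \<psi> n v X \<longleftrightarrow> X (2 * n)" for n X
    by (simp add: arith_holds_def \<psi>_def)
  have "{n. b n} = {n. \<exists>X. arith_holds (FAnd \<phi> \<psi>) n v X}"
    using ex un by (auto simp: sat \<psi>)
  then have "Sigma11_in v {n. b n}"
    unfolding Sigma11_in_def by blast
  moreover have "{n. b n} = {n. \<forall>X. arith_holds (FImp \<phi> \<psi>) n v X}"
    using ex un by (auto simp: sat \<psi>)
  then have "Pi11_in v {n. b n}"
    unfolding Pi11_in_def by blast
  ultimately show ?thesis
    by (simp add: hyp_le_def Delta11_in_def)
qed

text \<open>There are countably many formulas, and each can serve for at most one \<open>b\<close>,
  the even part of any of its solutions.\<close>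

lemma countable_hyp: "countable {b. hyp b v}"
proof -
  have "{b. hyp b v} \<subseteq> range (\<lambda>\<phi>. \<lambda>n. (SOME X. holds (env2 v X) \<phi>) (2 * n))"
  proof
    fix b assume "b \<in> {b. hyp b v}"
    then obtain \<phi> where ex: "\<exists>X. holds (env2 v X) \<phi>"
      and un: "\<And>X n. holds (env2 v X) \<phi> \<Longrightarrow> b n = X (2 * n)"
      unfolding hyp_def by blast
    from ex have "holds (env2 v (SOME X. holds (env2 v X) \<phi>)) \<phi>"
      by (rule someI_ex)
    then show "b \<in> range (\<lambda>\<phi>. \<lambda>n. (SOME X. holds (env2 v X) \<phi>) (2 * n))"
      by (intro image_eqI[of _ _ \<phi>] ext un UNIV_I)
  qed
  then show ?thesis
    by (rule countable_subset) (intro countable_image countableI_type)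
qed

definition env6 :: "cantor \<Rightarrow> cantor \<Rightarrow> cantor \<Rightarrow> cantor \<Rightarrow> cantor \<Rightarrow> cantor \<Rightarrow> nat \<Rightarrow> cantor" where
  "env6 b X c1 c2 c3 c4 = (\<lambda>_ _. False)(0 := b, 1 := X, 2 := c1, 3 := c2, 4 := c3, 5 := c4)"

lemma env6_simps [simp]:
  "env6 b X c1 c2 c3 c4 0 = b"
  "env6 b X c1 c2 c3 c4 (Suc 0) = X"
  "env6 b X c1 c2 c3 c4 2 = c1"
  "env6 b X c1 c2 c3 c4 3 = c2"
  "env6 b X c1 c2 c3 c4 4 = c3"
  "env6 b X c1 c2 c3 c4 5 = c4"
  by (simp_all add: env6_def)

text \<open>The witness for \<open>b\<close> packs \<open>b\<close> on the even numbers, and \<open>X\<close> together with the witnesses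
  for the four parameters on the odd residue classes modulo 10.\<close>

lemma hyp_definable:
  assumes c: "hyp c1 v" "hyp c2 v" "hyp c3 v" "hyp c4 v"
    and cl: "closed_fm \<phi>"
    and ex: "\<exists>X. holds (env6 b X c1 c2 c3 c4) \<phi>"
    and un: "\<And>b' X. holds (env6 b' X c1 c2 c3 c4) \<phi> \<Longrightarrow> b' = b"
  shows "hyp b v"
proof -
  obtain \<psi>1 Y1 where cl1: "closed_fm \<psi>1" and Y1: "holds (env2 v Y1) \<psi>1"
    and un1: "\<And>X n. holds (env2 v X) \<psi>1 \<Longrightarrow> c1 n = X (2 * n)"
    using c(1) unfolding hyp_def by blast
  obtain \<psi>2 Y2 where cl2: "closed_fm \<psi>2" and Y2: "holds (env2 v Y2) \<psi>2"
    and un2: "\<And>X n. holds (env2 v X) \<psi>2 \<Longrightarrow> c2 n = X (2 * n)"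
    using c(2) unfolding hyp_def by blast
  obtain \<psi>3 Y3 where cl3: "closed_fm \<psi>3" and Y3: "holds (env2 v Y3) \<psi>3"
    and un3: "\<And>X n. holds (env2 v X) \<psi>3 \<Longrightarrow> c3 n = X (2 * n)"
    using c(3) unfolding hyp_def by blast
  obtain \<psi>4 Y4 where cl4: "closed_fm \<psi>4" and Y4: "holds (env2 v Y4) \<psi>4"
    and un4: "\<And>X n. holds (env2 v X) \<psi>4 \<Longrightarrow> c4 n = X (2 * n)"
    using c(4) unfolding hyp_def by blast
  obtain X0 where X0: "holds (env6 b X0 c1 c2 c3 c4) \<phi>"
    using ex by blast
  define sub where "sub r = fm_subst (\<lambda>i. i) ((\<lambda>_. 1)(1 := 10)) ((\<lambda>_. 0)(1 := r))" for r
  \<comment> \<open>The witness for a parameter lies on the progression 10n + r and holds the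
    parameter on its even part, so the parameter itself is found on 20n + r. Set variables above 5
    go to variable 2, which is empty in \<open>env2\<close>.\<close>
  define main where "main = fm_subst ((\<lambda>_. 2)(0 := 1, 1 := 1, 2 := 1, 3 := 1, 4 := 1, 5 := 1))
    ((\<lambda>_. 0)(0 := 2, 1 := 10, 2 := 20, 3 := 20, 4 := 20, 5 := 20))
    ((\<lambda>_. 0)(0 := 0, 1 := 1, 2 := 3, 3 := 5, 4 := 7, 5 := 9)) \<phi>"
  define \<Phi> where "\<Phi> = FAnd main (FAnd (sub 3 \<psi>1) (FAnd (sub 5 \<psi>2) (FAnd (sub 7 \<psi>3) (sub 9 \<psi>4))))"
  have sub: "holds (env2 v Z) (sub r \<psi>) \<longleftrightarrow> holds (env2 v (\<lambda>n. Z (10 * n + r))) \<psi>" for Z r \<psi>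
  proof -
    have "(\<lambda>i n. env2 v Z i (((\<lambda>_. 1)(1 := 10)) i * n + ((\<lambda>_. 0)(1 := r)) i))
      = env2 v (\<lambda>n. Z (10 * n + r))"
      by (auto simp: env2_def fun_eq_iff)
    then show ?thesis
      unfolding sub_def by simp
  qed
  have main: "holds (env2 v Z) main \<longleftrightarrow> holds (env6 (\<lambda>n. Z (2 * n)) (\<lambda>n. Z (10 * n + 1))
      (\<lambda>n. Z (20 * n + 3)) (\<lambda>n. Z (20 * n + 5)) (\<lambda>n. Z (20 * n + 7)) (\<lambda>n. Z (20 * n + 9))) \<phi>" for Z
    unfolding main_def arith_sat_subst
    by (rule arg_cong[where f = "\<lambda>S. holds S \<phi>"]) (auto simp: env2_def env6_def fun_eq_iff)
  have "closed_fm \<Phi>"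
    using cl cl1 cl2 cl3 cl4 unfolding \<Phi>_def main_def sub_def by blast
  moreover have "\<exists>Z. holds (env2 v Z) \<Phi>"
  proof -
    define Z where "Z n = (if even n then b (n div 2) else if n mod 10 = 1 then X0 (n div 10)
      else if n mod 10 = 3 then Y1 (n div 10) else if n mod 10 = 5 then Y2 (n div 10)
      else if n mod 10 = 7 then Y3 (n div 10) else Y4 (n div 10))" for n
    have "Suc (10 * n) div 10 = n" for n :: nat
      by presburger
    then have Z: "(\<lambda>n. Z (2 * n)) = b" "(\<lambda>n. Z (10 * n + 1)) = X0" "(\<lambda>n. Z (10 * n + 3)) = Y1"
      "(\<lambda>n. Z (10 * n + 5)) = Y2" "(\<lambda>n. Z (10 * n + 7)) = Y3" "(\<lambda>n. Z (10 * n + 9)) = Y4"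
      by (auto simp: Z_def fun_eq_iff)
    have "Z (20 * n + 3) = c1 n" "Z (20 * n + 5) = c2 n" "Z (20 * n + 7) = c3 n"
      "Z (20 * n + 9) = c4 n" for n
      using Z(3-6)[THEN fun_cong, of "2 * n"] un1[OF Y1, of n] un2[OF Y2, of n] un3[OF Y3, of n]
        un4[OF Y4, of n] by auto
    then show ?thesis
      using X0 Y1 Y2 Y3 Y4 unfolding \<Phi>_def by (intro exI[of _ Z]) (simp add: main sub Z del: One_nat_def)
  qed
  moreover have "b n = Z (2 * n)" if "holds (env2 v Z) \<Phi>" for Z n
  proof -
    have s: "holds (env2 v (\<lambda>n. Z (10 * n + 3))) \<psi>1" "holds (env2 v (\<lambda>n. Z (10 * n + 5))) \<psi>2"
      "holds (env2 v (\<lambda>n. Z (10 * n + 7))) \<psi>3" "holds (env2 v (\<lambda>n. Z (10 * n + 9))) \<psi>4"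
      and m: "holds (env2 v Z) main"
      using that unfolding \<Phi>_def by (auto simp: sub)
    have "(\<lambda>n. Z (20 * n + 3)) = c1" "(\<lambda>n. Z (20 * n + 5)) = c2" "(\<lambda>n. Z (20 * n + 7)) = c3"
      "(\<lambda>n. Z (20 * n + 9)) = c4"
      using un1[OF s(1)] un2[OF s(2)] un3[OF s(3)] un4[OF s(4)] by (auto simp: fun_eq_iff)
    with m have "holds (env6 (\<lambda>n. Z (2 * n)) (\<lambda>n. Z (10 * n + 1)) c1 c2 c3 c4) \<phi>"
      unfolding main by simp
    from un[OF this, THEN fun_cong, of n] show ?thesis
      by simp
  qed
  ultimately show ?thesis
    unfolding hyp_def by blast
qed

text \<open>Explicit definition from the parameters: \<open>\<phi>\<close> is insensitive to set
  variables 0 and 1, the unknown and the witness, so stating that variable 0 is the set defined by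
  \<open>\<phi>\<close> has exactly one solution.\<close>

lemma hyp_comprehension:
  assumes c: "hyp c1 v" "hyp c2 v" "hyp c3 v" "hyp c4 v"
    and b: "\<And>e X b' n. arith_sat (e(0 := n)) (env6 b' X c1 c2 c3 c4) \<phi> \<longleftrightarrow> b n"
    and cl: "closed_fm (FAll 0 (FIff (FMem (NVar 0) 0) \<phi>))"
  shows "hyp b v"
  by (rule hyp_definable[OF c cl]) (auto simp: b)

section \<open>Reflexivity, transitivity and joins\<close>

lemma hyp_refl: "hyp v v"
proof -
  define \<phi> where "\<phi> = FAll 0 (FIff (FMem (NVar 0) 0) (FMem (NMul (nnum 2) (NVar 0)) 1))"
  have \<phi>: "holds (env2 v X) \<phi> \<longleftrightarrow> (\<forall>n. v n = X (2 * n))" for X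
    by (simp add: \<phi>_def env2_def)
  have "closed_fm \<phi>"
    by (simp add: \<phi>_def closed_fm_def)
  moreover have "holds (env2 v (\<lambda>n. v (n div 2))) \<phi>"
    by (simp add: \<phi>)
  ultimately show ?thesis
    unfolding hyp_def using \<phi> by blast
qed

lemma hyp_trans:
  assumes "hyp b c" "hyp c v"
  shows "hyp b v"
proof -
  obtain \<phi> X0 where cl: "closed_fm \<phi>" and X0: "holds (env2 c X0) \<phi>"
    and un: "\<And>X n. holds (env2 c X) \<phi> \<Longrightarrow> b n = X (2 * n)"
    using assms(1) unfolding hyp_def by blast
  \<comment> \<open>Set variable 6 is empty in \<open>env6\<close>, as are all but the first two in
    \<open>env2\<close>.\<close>
  define sub where "sub = fm_subst ((\<lambda>_. 6)(0 := 2, 1 := 1)) (\<lambda>_. 1) (\<lambda>_. 0) \<phi>"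
  have sub: "holds (env6 b' X c c c c) sub \<longleftrightarrow> holds (env2 c X) \<phi>" for b' X
    unfolding sub_def arith_sat_subst
    by (rule arg_cong[where f = "\<lambda>S. holds S \<phi>"]) (auto simp: env2_def env6_def fun_eq_iff)
  define \<Phi> where "\<Phi> = FAnd sub (FAll 0 (FIff (FMem (NVar 0) 0) (FMem (NMul (nnum 2) (NVar 0)) 1)))"
  show ?thesis
  proof (rule hyp_definable[OF assms(2,2,2,2)])
    show "closed_fm \<Phi>"
      using cl unfolding \<Phi>_def sub_def by (intro closed_fm_FAnd closed_fm_subst) (auto simp: closed_fm_def)
    show "\<exists>X. holds (env6 b X c c c c) \<Phi>"
      using X0 un[OF X0] unfolding \<Phi>_def by (intro exI[of _ X0]) (simp add: sub)
    show "b' = b" if "holds (env6 b' X c c c c) \<Phi>" for b' X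
    proof
      fix n
      have "holds (env2 c X) \<phi>" "b' n = X (2 * n)"
        using that unfolding \<Phi>_def by (simp_all add: sub)
      then show "b' n = b n"
        using un by simp
    qed
  qed
qed

lemma hyp_join_left: "hyp x (x \<oplus> y)"
  by (rule hyp_comprehension[OF hyp_refl hyp_refl hyp_refl hyp_refl, of _ "FMem (NMul (nnum 2) (NVar 0)) 2"])
    (auto simp: turing_join_def closed_fm_def)

lemma hyp_join_right: "hyp y (x \<oplus> y)"
  by (rule hyp_comprehension[OF hyp_refl hyp_refl hyp_refl hyp_refl,
        of _ "FMem (NSuc (NMul (nnum 2) (NVar 0))) 2"])
    (auto simp: turing_join_def closed_fm_def)

lemma hyp_join:
  assumes "hyp x v" "hyp y v"
  shows "hyp (x \<oplus> y) v"
proof (rule hyp_definable[OF assms assms, where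
    \<phi> = "FAll 0 (FAnd (FIff (FMem (NMul (nnum 2) (NVar 0)) 0) (FMem (NVar 0) 2))
          (FIff (FMem (NSuc (NMul (nnum 2) (NVar 0))) 0) (FMem (NVar 0) 3)))"])
  show "b' = x \<oplus> y" if "holds (env6 b' X x y x y)
      (FAll 0 (FAnd (FIff (FMem (NMul (nnum 2) (NVar 0)) 0) (FMem (NVar 0) 2))
          (FIff (FMem (NSuc (NMul (nnum 2) (NVar 0))) 0) (FMem (NVar 0) 3))))" for b' X
  proof
    fix n
    show "b' n = (x \<oplus> y) n"
    proof (cases "even n")
      case True
      then obtain k where "n = 2 * k" by blast
      then show ?thesis
        using that by (simp add: turing_join_def)
    next
      case False
      then obtain k where "n = 2 * k + 1" using oddE by blast
      then show ?thesis
        using that by (simp add: turing_join_def)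
    qed
  qed
qed (auto simp: turing_join_def closed_fm_def)

section \<open>Perfect kernels and ranks\<close>

text \<open>\<open>P s u v\<close> will mean that \<open>u\<close> and \<open>v\<close> are
  incompatible extensions of \<open>s\<close>, so that \<open>J\<close> generates a perfect tree.
  Closure under prefixes is proved later, for the kernel.\<close>

definition perfect :: "(nat \<Rightarrow> bool) \<Rightarrow> (nat \<Rightarrow> nat \<Rightarrow> nat \<Rightarrow> bool) \<Rightarrow> (nat \<Rightarrow> bool) \<Rightarrow> bool" where
  "perfect T P J \<longleftrightarrow> (\<forall>s. J s \<longrightarrow> T s \<and> (\<exists>u v. P s u v \<and> J u \<and> J v))"

definition kernel :: "(nat \<Rightarrow> bool) \<Rightarrow> (nat \<Rightarrow> nat \<Rightarrow> nat \<Rightarrow> bool) \<Rightarrow> nat \<Rightarrow> bool" where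
  "kernel T P s \<longleftrightarrow> (\<exists>J. perfect T P J \<and> J s)"

lemma perfect_imp_kernel: "perfect T P J \<Longrightarrow> J s \<Longrightarrow> kernel T P s"
  by (auto simp: kernel_def)

lemma perfect_kernel: "perfect T P (kernel T P)"
  unfolding perfect_def
proof (intro allI impI)
  fix s assume "kernel T P s"
  then obtain J where J: "perfect T P J" "J s"
    unfolding kernel_def by blast
  then have "T s \<and> (\<exists>u v. P s u v \<and> J u \<and> J v)"
    unfolding perfect_def by blast
  then show "T s \<and> (\<exists>u v. P s u v \<and> kernel T P u \<and> kernel T P v)"
    using perfect_imp_kernel[OF J(1)] by blast
qed

text \<open>Read \<open>L u s\<close> as: the Cantor-Bendixson rank of \<open>u\<close> is below
  that of \<open>s\<close>. The clauses are negative transitivity and the two halves of the equation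
  rank s = sup (min (rank u) (rank v) + 1) over the pairs with \<open>P s u v\<close>, nodes outside
  \<open>T\<close> having rank 0.\<close>

definition rank_order :: "(nat \<Rightarrow> bool) \<Rightarrow> (nat \<Rightarrow> nat \<Rightarrow> nat \<Rightarrow> bool) \<Rightarrow> (nat \<Rightarrow> nat \<Rightarrow> bool) \<Rightarrow> bool" where
  "rank_order T P L \<longleftrightarrow>
     (\<forall>u s r. L u s \<longrightarrow> L u r \<or> L r s) \<and>
     (\<forall>s u v. T s \<and> P s u v \<longrightarrow> L u s \<or> L v s) \<and>
     (\<forall>w s. L w s \<longrightarrow> T s \<and> (\<exists>u v. P s u v \<and> \<not> L u w \<and> \<not> L v w))"

text \<open>Well-foundedness, which is not arithmetical, is assumed of \<open>L\<close> only, so the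
  arithmetical clauses have no other solution once they have a well-founded one. Induction along
  \<open>L\<close> shows that \<open>s\<close> has the same predecessors in both relations.\<close>

lemma rank_order_unique:
  assumes wf: "wfp L" and L: "rank_order T P L" and L': "rank_order T P L'"
  shows "L' = L"
proof -
  have n: "\<And>u s r. L u s \<Longrightarrow> L u r \<or> L r s" and a: "\<And>s u v. T s \<Longrightarrow> P s u v \<Longrightarrow> L u s \<or> L v s"
    and b: "\<And>w s. L w s \<Longrightarrow> T s \<and> (\<exists>u v. P s u v \<and> \<not> L u w \<and> \<not> L v w)"
    using L unfolding rank_order_def by blast+
  have n': "\<And>u s r. L' u s \<Longrightarrow> L' u r \<or> L' r s" and a': "\<And>s u v. T s \<Longrightarrow> P s u v \<Longrightarrow> L' u s \<or> L' v s"
    and b': "\<And>w s. L' w s \<Longrightarrow> T s \<and> (\<exists>u v. P s u v \<and> \<not> L' u w \<and> \<not> L' v w)"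
    using L' unfolding rank_order_def by blast+
  have "\<forall>r. L r s \<longleftrightarrow> L' r s" for s
    using wf
  proof (induction s rule: wfp_induct_rule)
    case (less s)
    \<comment> \<open>\<open>L\<close> provides a pair below \<open>r\<close> neither member of
      which precedes \<open>u\<close>. The predecessors of \<open>u\<close> agree, so the same holds
      for \<open>L'\<close>, whose clauses then put \<open>u\<close> below \<open>r\<close>.\<close>
    have up: "L' u r" if "L u r" and IH: "\<forall>w. L w u \<longleftrightarrow> L' w u" for u r
    proof -
      obtain u' v' where "T r" "P r u' v'" "\<not> L u' u" "\<not> L v' u"
        using b[OF \<open>L u r\<close>] by blast
      then show ?thesis
        using a'[of r u' v'] n'[of u' r u] n'[of v' r u] IH by blast
    qed
    show ?case
    proof (intro allI iffI)
      fix r assume "L r s"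
      then show "L' r s"
        using up less.IH by blast
    next
      fix r assume "L' r s"
      then obtain u v where "T s" "P s u v" "\<not> L' u r" "\<not> L' v r"
        using b' by blast
      then obtain u where u: "L u s" "\<not> L' u r"
        using a by blast
      show "L r s"
      proof (rule ccontr)
        assume "\<not> L r s"
        then have "L u r"
          using n[OF u(1)] by blast
        then show False
          using up less.IH u by blast
      qed
    qed
  qed
  then show ?thesis
    by (intro ext) blast
qed

section \<open>Iterated Cantor-Bendixson derivatives\<close>

context
  fixes T :: "nat \<Rightarrow> bool" and P :: "nat \<Rightarrow> nat \<Rightarrow> nat \<Rightarrow> bool"
begin

definition removed :: "nat set \<Rightarrow> nat set" where
  "removed N = {s. T s \<longrightarrow> \<not> (\<exists>u v. P s u v \<and> u \<notin> N \<and> v \<notin> N)}"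

lemma removed_mono: "M \<subseteq> N \<Longrightarrow> removed M \<subseteq> removed N"
  unfolding removed_def by blast

text \<open>The transfinite iteration of \<open>removed\<close> without ordinals; the empty union
  provides the start.\<close>

inductive_set stages :: "nat set set" where
  step: "N \<in> stages \<Longrightarrow> removed N \<in> stages"
| Union: "(\<And>M. M \<in> \<M> \<Longrightarrow> M \<in> stages) \<Longrightarrow> \<Union>\<M> \<in> stages"

text \<open>The usual double induction for towers; monotonicity of \<open>removed\<close>
  suffices.\<close>

lemma stages_comparable: "M \<in> stages \<Longrightarrow> N \<in> stages \<Longrightarrow> M \<subseteq> N \<or> removed N \<subseteq> M"
proof (induction arbitrary: N rule: stages.induct)
  case (step M)
  have "N \<subseteq> M \<or> removed M \<subseteq> N"
    using step.prems
  proof (induction rule: stages.induct)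
    case (step N)
    then show ?case
      using \<open>\<And>N. N \<in> stages \<Longrightarrow> M \<subseteq> N \<or> removed N \<subseteq> M\<close>[of N] removed_mono by blast
  next
    case (Union \<N>)
    then show ?case by blast
  qed
  then show ?case
    using removed_mono by blast
next
  case (Union \<M>)
  then show ?case by blast
qed

definition stage_less :: "nat \<Rightarrow> nat \<Rightarrow> bool" where
  "stage_less u s \<longleftrightarrow> (\<exists>N\<in>stages. u \<in> N \<and> s \<notin> N)"

definition stage_before :: "nat set \<Rightarrow> nat set" where
  "stage_before Q = \<Union>{M \<in> stages. M \<inter> Q = {}}"

lemma stage_before: "stage_before Q \<in> stages" "stage_before Q \<inter> Q = {}"
  unfolding stage_before_def by (rule stages.Union) auto

lemma stage_before_greatest: "M \<in> stages \<Longrightarrow> M \<inter> Q = {} \<Longrightarrow> M \<subseteq> stage_before Q"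
  unfolding stage_before_def by blast

text \<open>If the next stage still missed \<open>Q\<close>, the iteration would have stopped, and
  the complement would be perfect, hence empty, although it contains \<open>Q\<close>.\<close>

lemma removed_stage_before:
  assumes "\<And>s. \<not> kernel T P s" "Q \<noteq> {}"
  shows "removed (stage_before Q) \<inter> Q \<noteq> {}"
proof
  assume "removed (stage_before Q) \<inter> Q = {}"
  then have "removed (stage_before Q) \<subseteq> stage_before Q"
    using stage_before_greatest stages.step[OF stage_before(1)] by blast
  then have "perfect T P (\<lambda>s. s \<notin> stage_before Q)"
    unfolding perfect_def removed_def by blast
  then have "stage_before Q = UNIV"
    using assms(1) perfect_imp_kernel by fastforce
  then show False
    using stage_before(2)[of Q] assms(2) by blast
qed

lemma wfp_stage_less:
  assumes "\<And>s. \<not> kernel T P s"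
  shows "wfp stage_less"
proof (unfold wfp_iff_ex_minimal, intro allI impI)
  fix Q :: "nat set" assume "Q \<noteq> {}"
  \<comment> \<open>A member of \<open>Q\<close> that is removed at the first opportunity is
    minimal.\<close>
  then obtain q where q: "q \<in> Q" "q \<in> removed (stage_before Q)"
    using removed_stage_before[OF assms] by blast
  have "\<not> stage_less r q" if "r \<in> Q" for r
  proof
    assume "stage_less r q"
    then obtain M where "M \<in> stages" "r \<in> M" "q \<notin> M"
      unfolding stage_less_def by blast
    then show False
      using stages_comparable[OF _ stage_before(1)] stage_before(2)[of Q] q that by blast
  qed
  then show "\<exists>z\<in>Q. \<forall>y. stage_less y z \<longrightarrow> y \<notin> Q"
    using q by blast
qed

lemma rank_order_stage_less:
  assumes "\<And>s. \<not> kernel T P s"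
  shows "rank_order T P stage_less"
  unfolding rank_order_def
proof (intro conjI allI impI)
  show "stage_less u r \<or> stage_less r s" if "stage_less u s" for u s r
    using that unfolding stage_less_def by blast
  show "stage_less u s \<or> stage_less v s" if "T s \<and> P s u v" for s u v
  proof -
    \<comment> \<open>\<open>s\<close> is removed right after \<open>stage_before {s}\<close>, so
      every pair splitting it has a member there.\<close>
    have "s \<in> removed (stage_before {s})"
      using removed_stage_before[OF assms, of "{s}"] by blast
    then have "u \<in> stage_before {s} \<or> v \<in> stage_before {s}"
      using that unfolding removed_def by blast
    moreover have "stage_before {s} \<in> stages" "s \<notin> stage_before {s}"
      using stage_before[of "{s}"] by auto
    ultimately show ?thesis
      unfolding stage_less_def by metis
  qed
  fix w s assume "stage_less w s"
  then obtain M where M: "M \<in> stages" "w \<in> M" "s \<notin> M"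
    unfolding stage_less_def by blast
  \<comment> \<open>\<open>M\<close> contains \<open>w\<close>, so it is not included in
    \<open>stage_before {w}\<close> and must include the next stage. As \<open>M\<close> misses
    \<open>s\<close>, that stage does not remove \<open>s\<close>.\<close>
  have "s \<notin> removed (stage_before {w})"
    using stages_comparable[OF M(1) stage_before(1)[of "{w}"]] stage_before(2)[of "{w}"] M by blast
  then obtain u v where "T s" "P s u v" "u \<notin> stage_before {w}" "v \<notin> stage_before {w}"
    unfolding removed_def by blast
  moreover have "\<not> stage_less r w" if "r \<notin> stage_before {w}" for r
    using that stage_before_greatest[of _ "{w}"] unfolding stage_less_def by blast
  ultimately show "T s" "\<exists>u v. P s u v \<and> \<not> stage_less u w \<and> \<not> stage_less v w"
    by auto
qed

text \<open>The bounded derivatives: by the pigeonhole principle, \<open>\<omega>\<close> steps reach a perfect set, which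
  is the whole kernel as soon as the bounds are large enough.\<close>

primrec bounded_deriv :: "(nat \<Rightarrow> nat \<Rightarrow> bool) \<Rightarrow> nat \<Rightarrow> nat \<Rightarrow> bool" where
  "bounded_deriv bd 0 s \<longleftrightarrow> T s"
| "bounded_deriv bd (Suc n) s \<longleftrightarrow> bounded_deriv bd n s \<and>
     (\<exists>u v. P s u v \<and> bd s u \<and> bd s v \<and> bounded_deriv bd n u \<and> bounded_deriv bd n v)"

lemma bounded_deriv_antimono: "m \<le> n \<Longrightarrow> bounded_deriv bd n s \<Longrightarrow> bounded_deriv bd m s"
  by (induction n rule: nat_induct) (auto simp: le_Suc_eq simp del: bounded_deriv.simps(2), auto)

lemma perfect_bounded_deriv:
  assumes fin: "\<And>s. \<exists>m. \<forall>u. bd s u \<longrightarrow> u \<le> m"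
  shows "perfect T P (\<lambda>s. \<forall>n. bounded_deriv bd n s)"
  unfolding perfect_def
proof (intro allI impI conjI)
  fix s assume s: "\<forall>n. bounded_deriv bd n s"
  show "T s"
    using s[rule_format, of 0] by simp
  obtain m where m: "\<And>u. bd s u \<Longrightarrow> u \<le> m"
    using fin by blast
  \<comment> \<open>Only finitely many pairs lie below the bound \<open>m\<close>, so one of them
    serves infinitely many \<open>n\<close>, and then all \<open>n\<close> by antitonicity.\<close>
  define good where "good n p \<longleftrightarrow> P s (fst p) (snd p) \<and> fst p \<le> m \<and> snd p \<le> m \<and>
    bounded_deriv bd n (fst p) \<and> bounded_deriv bd n (snd p)" for n and p :: "nat \<times> nat"
  have "\<exists>p. good n p" for n
  proof -
    obtain u v where "P s u v" "bd s u" "bd s v" "bounded_deriv bd n u" "bounded_deriv bd n v"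
      using s[rule_format, of "Suc n"] by auto
    then have "good n (u, v)"
      unfolding good_def using m by auto
    then show ?thesis by blast
  qed
  then obtain p where p: "\<And>n. good n (p n)"
    by metis
  have "range p \<subseteq> {..m} \<times> {..m}"
  proof (intro subsetI, elim rangeE)
    fix x n assume "x = p n"
    then show "x \<in> {..m} \<times> {..m}"
      using p[of n] unfolding good_def by (simp add: mem_Times_iff)
  qed
  then have "finite (range p)"
    by (rule finite_subset) auto
  then obtain k where k: "infinite {n. p n = p k}"
    using pigeonhole_infinite[of "UNIV :: nat set" p] by auto
  define q where "q = p k"
  have q: "infinite {n. p n = q}"
    using k by (simp add: q_def)
  have "good n q" for n
  proof -
    have "\<forall>m. \<exists>k>m. k \<in> {n. p n = q}"
      using q unfolding infinite_nat_iff_unbounded .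
    then obtain k where "k > n" "p k = q"
      by blast
    then show ?thesis
      using p[of k] bounded_deriv_antimono[of n k bd] unfolding good_def by auto
  qed
  then show "\<exists>u v. P s u v \<and> (\<forall>n. bounded_deriv bd n u) \<and> (\<forall>n. bounded_deriv bd n v)"
    unfolding good_def by blast
qed

lemma kernel_imp_bounded_deriv:
  assumes bd: "\<And>s. kernel T P s \<Longrightarrow>
    \<exists>u v. P s u v \<and> kernel T P u \<and> kernel T P v \<and> bd s u \<and> bd s v"
  shows "kernel T P s \<Longrightarrow> bounded_deriv bd n s"
proof (induction n arbitrary: s)
  case 0
  then show ?case
    using perfect_kernel[of T P] unfolding perfect_def by simp
next
  case (Suc n)
  then show ?case
    using bd[of s] by auto
qed

end

section \<open>Borel sets as injective projections of closed sets\<close>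

lemma open_cantor_prefix:
  fixes U :: "cantor set"
  assumes "open U" "x \<in> U"
  shows "\<exists>n. \<forall>x'. (\<forall>i<n. x' i = x i) \<longrightarrow> x' \<in> U"
proof -
  have "openin (product_topology (\<lambda>_. euclidean) UNIV) U"
    using assms(1) unfolding open_fun_def .
  from product_topology_open_contains_basis[OF this assms(2)] obtain X where
    X: "x \<in> (\<Pi>\<^sub>E i\<in>UNIV. X i)" "finite {i. X i \<noteq> UNIV}" "(\<Pi>\<^sub>E i\<in>UNIV. X i) \<subseteq> U"
    by auto
  obtain n where n: "\<And>i. X i \<noteq> UNIV \<Longrightarrow> i < n"
    using X(2) finite_nat_set_iff_bounded by auto
  have "x' \<in> U" if "\<forall>i<n. x' i = x i" for x'
  proof -
    have "x' i \<in> X i" for i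
      using n[of i] that X(1) by (cases "i < n") (auto simp: PiE_iff)
    then show ?thesis
      using X(3) by (auto simp: PiE_iff)
  qed
  then show ?thesis by blast
qed

text \<open>One \<open>n\<close> serves all arguments, which is stronger than clopenness because
  Baire space is not compact. It tells how long a prefix must be to decide \<open>R\<close>.\<close>

definition fin_det :: "(cantor \<times> cantor \<Rightarrow> (nat \<Rightarrow> nat) \<Rightarrow> bool) \<Rightarrow> bool" where
  "fin_det R \<longleftrightarrow> (\<exists>n. \<forall>z z' y y' h h'. (\<forall>i<n. z i = z' i \<and> y i = y' i \<and> h i = h' i) \<longrightarrow>
     R (z, y) h = R (z', y') h')"

lemma fin_det_conj:
  assumes "fin_det R" "fin_det R'"
  shows "fin_det (\<lambda>p h. R p h \<and> R' p h)"
proof -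
  obtain n where n: "\<And>z z' y y' h h'. \<forall>i<n. z i = z' i \<and> y i = y' i \<and> h i = h' i \<Longrightarrow>
     R (z, y) h = R (z', y') h'"
    using assms(1) unfolding fin_det_def by blast
  obtain n' where n': "\<And>z z' y y' h h'. \<forall>i<n'. z i = z' i \<and> y i = y' i \<and> h i = h' i \<Longrightarrow>
     R' (z, y) h = R' (z', y') h'"
    using assms(2) unfolding fin_det_def by blast
  show ?thesis
    unfolding fin_det_def
  proof (rule exI[of _ "max n n'"], intro allI impI)
    fix z z' y y' :: cantor and h h' :: "nat \<Rightarrow> nat"
    assume "\<forall>i<max n n'. z i = z' i \<and> y i = y' i \<and> h i = h' i"
    then have "R (z, y) h = R (z', y') h'" "R' (z, y) h = R' (z', y') h'"
      by (auto intro!: n n')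
    then show "(R (z, y) h \<and> R' (z, y) h) = (R (z', y') h' \<and> R' (z', y') h')"
      by simp
  qed
qed

lemma fin_det_reindex:
  assumes "fin_det R"
  shows "fin_det (\<lambda>p h. R p (\<lambda>n. h (\<rho> n)))"
proof -
  obtain n where n: "\<And>z z' y y' h h'. \<forall>i<n. z i = z' i \<and> y i = y' i \<and> h i = h' i \<Longrightarrow>
     R (z, y) h = R (z', y') h'"
    using assms(1) unfolding fin_det_def by blast
  obtain N where N: "\<And>i. i \<in> {..<n} \<union> \<rho> ` {..<n} \<Longrightarrow> i < N"
    using finite_nat_set_iff_bounded[of "{..<n} \<union> \<rho> ` {..<n}"] by auto
  show ?thesis
    unfolding fin_det_def
    by (rule exI[of _ N], intro allI impI n) (auto intro: N)
qed

lemma fin_det_coord: "fin_det (\<lambda>p h. Q (h i) (h j) (h k))"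
  unfolding fin_det_def by (rule exI[of _ "Suc (i + j + k)"]) auto

text \<open>\<open>G\<close> is the preimage of a clopen set under a function into Baire space with closed graph.
  All Borel sets are of this form.\<close>

definition closed_graph_set :: "(cantor \<times> cantor) set \<Rightarrow> bool" where
  "closed_graph_set G \<longleftrightarrow> (\<exists>R H. (\<forall>k::nat. fin_det (R k)) \<and> (\<forall>p h. (\<forall>k. R k p h) \<longleftrightarrow> h = H p) \<and>
     G = {p. H p 0 = 0})"

lemma closed_graph_set_Compl:
  assumes "closed_graph_set G"
  shows "closed_graph_set (- G)"
proof -
  obtain R H where R: "\<And>k::nat. fin_det (R k)" and H: "\<And>p h. (\<forall>k. R k p h) \<longleftrightarrow> h = H p"
    and G: "G = {p. H p 0 = 0}"
    using assms unfolding closed_graph_set_def by blast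
  \<comment> \<open>The old value is shifted by one, and the new first coordinate negates the old
    test.\<close>
  define H' where "H' p = case_nat (if H p 0 = 0 then 1 else 0) (H p)" for p
  define R' where "R' k p h \<longleftrightarrow> R k p (\<lambda>n. h (Suc n)) \<and> h 0 = (if h 1 = 0 then 1 else 0)" for k p h
  have "fin_det (R' k)" for k
    unfolding R'_def
    by (rule fin_det_conj[OF fin_det_reindex[OF R]
          fin_det_coord[of "\<lambda>a b c. a = (if b = 0 then 1 else 0)" 0 1 0]])
  moreover have "(\<forall>k. R' k p h) \<longleftrightarrow> h = H' p" for p h
  proof -
    have "(\<forall>k. R' k p h) \<longleftrightarrow> (\<lambda>n. h (Suc n)) = H p \<and> h 0 = (if h 1 = 0 then 1 else 0)"
      unfolding R'_def using H by blast
    also have "\<dots> \<longleftrightarrow> h = H' p"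
      by (auto simp: H'_def fun_eq_iff split: nat.splits)
    finally show ?thesis .
  qed
  moreover have "- G = {p. H' p 0 = 0}"
    by (auto simp: G H'_def)
  ultimately show ?thesis
    unfolding closed_graph_set_def by blast
qed

text \<open>Coordinate 1 holds one plus the least \<open>i\<close> with \<open>p \<in> G i\<close>, and 0 if there is none.\<close>

lemma closed_graph_set_Union:
  assumes "\<And>i::nat. closed_graph_set (G i)"
  shows "closed_graph_set (\<Union>i. G i)"
proof -
  obtain R H where R: "\<And>i k::nat. fin_det (R i k)" and H: "\<And>i p h. (\<forall>k. R i k p h) \<longleftrightarrow> h = H i p"
    and G: "\<And>i. G i = {p. H i p 0 = 0}"
    using assms unfolding closed_graph_set_def by metis
  define part where "part i h = (\<lambda>n. h (Suc (Suc (prod_encode (i, n)))))" for i and h :: "nat \<Rightarrow> nat"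
  define ix where "ix p = (if \<exists>i. H i p 0 = 0 then Suc (LEAST i. H i p 0 = 0) else 0)" for p
  define H' where "H' p = case_nat (if ix p = 0 then 1 else 0) (case_nat (ix p)
    (\<lambda>m. H (fst (prod_decode m)) p (snd (prod_decode m))))" for p
  \<comment> \<open>Together these conditions force coordinate 1 to be \<open>ix p\<close>, while
    each of them reads finitely many coordinates: the value \<open>Suc j\<close> claims success at
    \<open>j\<close> and failure before, the value 0 failure everywhere.\<close>
  define cond where "cond i a b \<longleftrightarrow> (a = 0 \<longrightarrow> b \<noteq> 0) \<and> (a = Suc i \<longrightarrow> b = 0) \<and> (a > Suc i \<longrightarrow> b \<noteq> 0)"
    for i a b :: nat
  define R' where "R' m p h \<longleftrightarrow> (case prod_decode m of (i, k) \<Rightarrow>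
    R i k p (part i h) \<and> cond i (h 1) (part i h 0) \<and> h 0 = (if h 1 = 0 then 1 else 0))" for m p h
  have "fin_det (R' m)" for m
  proof -
    obtain i k where ik: "prod_decode m = (i, k)" by fastforce
    show ?thesis
      unfolding R'_def ik case_prod_conv part_def
      by (rule fin_det_conj[OF fin_det_reindex[OF R] fin_det_conj[OF
            fin_det_coord[of "\<lambda>a b c. cond i a b" 1 "Suc (Suc (prod_encode (i, 0)))" 0]
            fin_det_coord[of "\<lambda>a b c. a = (if b = 0 then 1 else 0)" 0 1 0]]])
  qed
  moreover have "(\<forall>m. R' m p h) \<longleftrightarrow> h = H' p" for p h
  proof -
    have "(\<forall>m. R' m p h) \<longleftrightarrow> (\<forall>i k. R' (prod_encode (i, k)) p h)"
      by (metis prod.exhaust prod_decode_inverse)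
    also have "\<dots> \<longleftrightarrow> (\<forall>i. part i h = H i p \<and> cond i (h 1) (part i h 0)) \<and>
      h 0 = (if h 1 = 0 then 1 else 0)"
      unfolding R'_def by (auto simp: H[symmetric])
    also have "\<dots> \<longleftrightarrow> (\<forall>i. part i h = H i p) \<and> (\<forall>i. cond i (h 1) (H i p 0)) \<and>
      h 0 = (if h 1 = 0 then 1 else 0)"
      by metis
    also have "(\<forall>i. cond i (h 1) (H i p 0)) \<longleftrightarrow> h 1 = ix p"
    proof
      assume c: "\<forall>i. cond i (h 1) (H i p 0)"
      show "h 1 = ix p"
      proof (cases "h 1")
        case 0
        then show ?thesis using c unfolding cond_def ix_def by auto
      next
        case (Suc j)
        then have "H j p 0 = 0" "\<And>i. i < j \<Longrightarrow> H i p 0 \<noteq> 0"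
          using c unfolding cond_def by auto
        then have "(LEAST i. H i p 0 = 0) = j"
          by (intro Least_equality) (use not_le_imp_less in blast)+
        then show ?thesis
          using Suc \<open>H j p 0 = 0\<close> unfolding ix_def by auto
      qed
    next
      assume "h 1 = ix p"
      then show "\<forall>i. cond i (h 1) (H i p 0)"
        unfolding cond_def ix_def by (auto dest: not_less_Least intro: LeastI)
    qed
    also have "(\<forall>i. part i h = H i p) \<and> h 1 = ix p \<and> h 0 = (if h 1 = 0 then 1 else 0) \<longleftrightarrow> h = H' p"
    proof
      assume a: "(\<forall>i. part i h = H i p) \<and> h 1 = ix p \<and> h 0 = (if h 1 = 0 then 1 else 0)"
      show "h = H' p"
      proof
        fix n
        have "h (Suc (Suc m)) = H (fst (prod_decode m)) p (snd (prod_decode m))" for m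
          using a unfolding part_def
          by (metis prod.collapse prod_decode_inverse)
        then show "h n = H' p n"
          using a by (auto simp: H'_def split: nat.splits)
      qed
    next
      assume "h = H' p"
      then show "(\<forall>i. part i h = H i p) \<and> h 1 = ix p \<and> h 0 = (if h 1 = 0 then 1 else 0)"
        by (auto simp: H'_def part_def)
    qed
    finally show ?thesis .
  qed
  moreover have "(\<Union>i. G i) = {p. H' p 0 = 0}"
    by (auto simp: G H'_def ix_def)
  ultimately show ?thesis
    unfolding closed_graph_set_def by blast
qed

lemma closed_graph_set_fin_det:
  assumes "\<And>z z' y y'. (\<forall>i<n::nat. z i = z' i \<and> y i = y' i) \<Longrightarrow> (z, y) \<in> G \<longleftrightarrow> (z', y') \<in> G"
  shows "closed_graph_set G"
proof -
  define H where "H p = (\<lambda>k::nat. if k = 0 \<and> p \<notin> G then 1 else 0::nat)" for p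
  have "fin_det (\<lambda>p h. h k = H p k)" for k
    unfolding fin_det_def
  proof (rule exI[of _ "Suc k + n"], intro allI impI)
    fix z z' y y' :: cantor and h h' :: "nat \<Rightarrow> nat"
    assume a: "\<forall>i<Suc k + n. z i = z' i \<and> y i = y' i \<and> h i = h' i"
    then have "(z, y) \<in> G \<longleftrightarrow> (z', y') \<in> G"
      by (intro assms) auto
    then show "(h k = H (z, y) k) = (h' k = H (z', y') k)"
      using a by (auto simp: H_def)
  qed
  then show ?thesis
    unfolding closed_graph_set_def
    by (intro exI[of _ "\<lambda>k p h. h k = H p k"] exI[of _ H]) (auto simp: H_def)
qed

lemma closed_graph_set_open:
  assumes "open U"
  shows "closed_graph_set U"
proof -
  define C where "C n = {(z, y). \<forall>z' y'. (\<forall>i<n. z' i = z i \<and> y' i = y i) \<longrightarrow> (z', y') \<in> U}" for n :: nat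
  have "closed_graph_set (C n)" for n
    by (rule closed_graph_set_fin_det[of n]) (auto simp: C_def)
  then have "closed_graph_set (\<Union>n. C n)"
    by (rule closed_graph_set_Union)
  moreover have "(\<Union>n. C n) = U"
  proof (intro equalityI subsetI)
    fix p assume "p \<in> U"
    obtain z y where p: "p = (z, y)" by fastforce
    obtain A B where AB: "open A" "open B" "z \<in> A" "y \<in> B" "A \<times> B \<subseteq> U"
      using \<open>p \<in> U\<close> \<open>open U\<close> unfolding open_prod_def p by (metis SigmaE2 SigmaI fst_conv mem_Times_iff snd_conv)
    obtain m where m: "\<And>x'. \<forall>i<m. x' i = z i \<Longrightarrow> x' \<in> A"
      using open_cantor_prefix[OF AB(1,3)] by blast
    obtain n where n: "\<And>x'. \<forall>i<n. x' i = y i \<Longrightarrow> x' \<in> B"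
      using open_cantor_prefix[OF AB(2,4)] by blast
    have "p \<in> C (max m n)"
      using m n AB(5) unfolding C_def p by fastforce
    then show "p \<in> (\<Union>n. C n)" by blast
  qed (auto simp: C_def)
  ultimately show ?thesis by simp
qed

lemma closed_graph_set_borel:
  assumes "G \<in> sets borel"
  shows "closed_graph_set G"
proof -
  have "G \<in> sigma_sets UNIV {S. open S}"
    using assms by (simp add: borel_def)
  then show ?thesis
  proof (induction rule: sigma_sets.induct)
    case (Basic a)
    then show ?case using closed_graph_set_open by blast
  next
    case Empty
    show ?case using closed_graph_set_open by blast
  next
    case (Compl a)
    then show ?case using closed_graph_set_Compl by (simp add: Compl_eq_Diff_UNIV)
  next
    case (Union a)
    then show ?case using closed_graph_set_Union by blast
  qed
qed

abbreviation pre :: "(nat \<Rightarrow> 'a) \<Rightarrow> nat \<Rightarrow> 'a list" where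
  "pre x n \<equiv> map x [0..<n]"

text \<open>A branch \<open>\<beta>\<close> codes the point \<open>odd \<circ> \<beta>\<close> together with the witness \<open>\<lambda>i. \<beta> i div 2\<close>.\<close>

lemma borel_branches:
  assumes "G \<in> sets borel"
  obtains Q :: "bool list \<Rightarrow> nat list \<Rightarrow> bool" where
    "\<And>z y. (z, y) \<in> G \<longleftrightarrow> (\<exists>\<beta>. (\<forall>n. Q (pre z n) (pre \<beta> n)) \<and> y = (\<lambda>i. odd (\<beta> i)))"
    "\<And>z \<beta> \<beta>'. (\<forall>n. Q (pre z n) (pre \<beta> n)) \<Longrightarrow> (\<forall>n. Q (pre z n) (pre \<beta>' n)) \<Longrightarrow>
       (\<And>i. odd (\<beta> i) = odd (\<beta>' i)) \<Longrightarrow> \<beta> = \<beta>'"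
proof -
  obtain R H where R: "\<And>k::nat. fin_det (R k)" and H: "\<And>p h. (\<forall>k. R k p h) \<longleftrightarrow> h = H p"
    and G: "G = {p. H p 0 = 0}"
    using closed_graph_set_borel[OF assms] unfolding closed_graph_set_def by blast
  have "\<exists>N. \<forall>k z z' y y' h h'. (\<forall>i<N k. z i = z' i \<and> y i = y' i \<and> h i = h' i) \<longrightarrow>
     R k (z, y) h = R k (z', y') h'"
    using R unfolding fin_det_def by (intro choice allI)
  then obtain N where N: "\<And>k z z' y y' h h'. \<forall>i<N k. z i = z' i \<and> y i = y' i \<and> h i = h' i \<Longrightarrow>
     R k (z, y) h = R k (z', y') h'"
    by blast
  \<comment> \<open>\<open>R k\<close> is tested only when the \<open>N k\<close> entries that
    decide it are present, so for lists of equal length the entries past the end do not matter. The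
    last clause expresses membership in \<open>G\<close>.\<close>
  define Q where "Q \<zeta> \<sigma> \<longleftrightarrow> (\<forall>k. N k \<le> length \<sigma> \<longrightarrow>
      R k (\<lambda>i. \<zeta> ! i, \<lambda>i. odd (\<sigma> ! i)) (\<lambda>i. \<sigma> ! i div 2)) \<and> (\<sigma> \<noteq> [] \<longrightarrow> \<sigma> ! 0 div 2 = 0)"
    for \<zeta> :: "bool list" and \<sigma> :: "nat list"
  have Q: "(\<forall>n. Q (pre z n) (pre \<beta> n)) \<longleftrightarrow>
    (\<lambda>i. \<beta> i div 2) = H (z, \<lambda>i. odd (\<beta> i)) \<and> \<beta> 0 div 2 = 0" for z \<beta>
  proof -
    have "R k (\<lambda>i. pre z n ! i, \<lambda>i. odd (pre \<beta> n ! i)) (\<lambda>i. pre \<beta> n ! i div 2) \<longleftrightarrow>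
      R k (z, \<lambda>i. odd (\<beta> i)) (\<lambda>i. \<beta> i div 2)" if "N k \<le> n" for k n
      using that by (intro N) auto
    then have "Q (pre z n) (pre \<beta> n) \<longleftrightarrow> (\<forall>k. N k \<le> n \<longrightarrow> R k (z, \<lambda>i. odd (\<beta> i)) (\<lambda>i. \<beta> i div 2))
       \<and> (n > 0 \<longrightarrow> \<beta> 0 div 2 = 0)" for n
      unfolding Q_def by auto
    then show ?thesis
      unfolding H[symmetric] by blast
  qed
  show thesis
  proof (rule that[of Q])
    show "(z, y) \<in> G \<longleftrightarrow> (\<exists>\<beta>. (\<forall>n. Q (pre z n) (pre \<beta> n)) \<and> y = (\<lambda>i. odd (\<beta> i)))" for z y
    proof
      assume "(z, y) \<in> G"
      define \<beta> where "\<beta> i = 2 * H (z, y) i + of_bool (y i)" for i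
      have "(\<lambda>i. odd (\<beta> i)) = y" "(\<lambda>i. \<beta> i div 2) = H (z, y)"
        by (auto simp: \<beta>_def fun_eq_iff)
      moreover from this have "\<beta> 0 div 2 = 0"
        using \<open>(z, y) \<in> G\<close> G by (metis (mono_tags) mem_Collect_eq)
      ultimately show "\<exists>\<beta>. (\<forall>n. Q (pre z n) (pre \<beta> n)) \<and> y = (\<lambda>i. odd (\<beta> i))"
        unfolding Q by (intro exI[of _ \<beta>]) auto
    next
      assume "\<exists>\<beta>. (\<forall>n. Q (pre z n) (pre \<beta> n)) \<and> y = (\<lambda>i. odd (\<beta> i))"
      then obtain \<beta> where "(\<lambda>i. \<beta> i div 2) = H (z, y)" "\<beta> 0 div 2 = 0"
        unfolding Q by blast
      then show "(z, y) \<in> G"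
        unfolding G by (metis (mono_tags) mem_Collect_eq)
    qed
    show "\<beta> = \<beta>'" if "\<forall>n. Q (pre z n) (pre \<beta> n)" "\<forall>n. Q (pre z n) (pre \<beta>' n)"
      "\<And>i. odd (\<beta> i) = odd (\<beta>' i)" for z \<beta> \<beta>'
    proof
      fix i
      have "(\<lambda>i. odd (\<beta> i)) = (\<lambda>i. odd (\<beta>' i))"
        using that(3) by blast
      then have "(\<lambda>i. \<beta> i div 2) = (\<lambda>i. \<beta>' i div 2)"
        using that(1,2) unfolding Q by simp
      then have "\<beta> i div 2 = \<beta>' i div 2"
        by (rule fun_cong)
      moreover have "\<beta> i mod 2 = \<beta>' i mod 2"
        using that(3)[of i] by (simp add: odd_iff_mod_2_eq_one mod2_eq_if)
      ultimately show "\<beta> i = \<beta>' i"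
        by (metis div_mult_mod_eq)
    qed
  qed
qed

section \<open>Coding along a sparse path\<close>

lemma prefix_pre_iff: "prefix (pre h m) (pre h n) \<longleftrightarrow> m \<le> n"
proof
  show "prefix (pre h m) (pre h n)" if "m \<le> n"
    using that by (metis le_add_diff_inverse map_append prefixI upt_add_eq_append zero_order(1))
qed (auto dest: prefix_length_le)

text \<open>A bit of \<open>b\<close> is stored as the parity of the number of branching nodes
  passed before a mark, a place where \<open>h\<close> is not leftmost; \<open>F\<close> keeps the
  marks apart. Marks and branchings can be recovered from \<open>h\<close> and
  \<open>S\<close>.\<close>

lemma coding_path:
  fixes S :: "nat list set" and F :: "nat \<Rightarrow> nat" and b :: cantor
  assumes Nil: "[] \<in> S" and down: "\<And>\<sigma> \<tau>. prefix \<sigma> \<tau> \<Longrightarrow> \<tau> \<in> S \<Longrightarrow> \<sigma> \<in> S"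
    and split: "\<And>\<sigma>. \<sigma> \<in> S \<Longrightarrow>
      \<exists>u v. u \<in> S \<and> v \<in> S \<and> prefix \<sigma> u \<and> prefix \<sigma> v \<and> \<not> prefix u v \<and> \<not> prefix v u"
  obtains h mk br where "\<And>n. pre h n \<in> S"
    "\<And>n. mk n \<longleftrightarrow> (\<exists>j<h n. pre h n @ [j] \<in> S)" "\<And>n. br n \<longleftrightarrow> (\<exists>j. j \<noteq> h n \<and> pre h n @ [j] \<in> S)"
    "\<And>n. \<exists>m\<ge>n. mk m" "\<And>m n. m < n \<Longrightarrow> mk m \<Longrightarrow> mk n \<Longrightarrow> F m \<le> n"
    "\<And>n. mk n \<Longrightarrow> b (card {m. m < n \<and> mk m}) \<longleftrightarrow> even (card {m. m < n \<and> br m})"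
proof -
  define lm where "lm \<sigma> = (LEAST j. \<sigma> @ [j] \<in> S)" for \<sigma>
  define branch where "branch \<sigma> \<longleftrightarrow> (\<exists>j. j \<noteq> lm \<sigma> \<and> \<sigma> @ [j] \<in> S)" for \<sigma>
  define sec where "sec \<sigma> = (SOME j. j \<noteq> lm \<sigma> \<and> \<sigma> @ [j] \<in> S)" for \<sigma>
  have child: "\<exists>j. \<sigma> @ [j] \<in> S" if \<sigma>: "\<sigma> \<in> S" for \<sigma>
  proof -
    obtain u where u: "u \<in> S" "prefix \<sigma> u" "\<sigma> \<noteq> u"
      using split[OF \<sigma>] by blast
    then obtain j \<tau> where "u = \<sigma> @ j # \<tau>"
      by (metis append.right_neutral neq_Nil_conv prefixE)
    then have "prefix (\<sigma> @ [j]) u"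
      by simp
    then show ?thesis
      using down u(1) by blast
  qed
  have lm: "\<sigma> @ [lm \<sigma>] \<in> S" if "\<sigma> \<in> S" for \<sigma>
    unfolding lm_def using child[OF that] by (rule LeastI_ex)
  have lm_le: "lm \<sigma> \<le> j" if "\<sigma> @ [j] \<in> S" for \<sigma> j
    unfolding lm_def using that by (rule Least_le)
  have sec: "sec \<sigma> \<noteq> lm \<sigma>" "\<sigma> @ [sec \<sigma>] \<in> S" if "branch \<sigma>" for \<sigma>
    using someI_ex[OF that[unfolded branch_def]] unfolding sec_def by auto
  have lm_sec: "lm \<sigma> < sec \<sigma>" if "branch \<sigma>" for \<sigma>
    using sec(1)[OF that] lm_le[OF sec(2)[OF that]] by simp
  \<comment> \<open>The state consists of the node, the length below which no mark is allowed, the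
    number of marks so far, and whether an even number of branching nodes has been passed. A mark is
    made at the first branching node beyond the bound whose parity equals the next bit.\<close>
  define step where "step = (\<lambda>(\<sigma>, tg, i, p). let t = (branch \<sigma> \<and> tg \<le> length \<sigma> \<and> p = b i) in
    (\<sigma> @ [if t then sec \<sigma> else lm \<sigma>], if t then max tg (F (length \<sigma>)) else tg,
     if t then Suc i else i, if branch \<sigma> then \<not> p else p))"
  define st where "st n = (step ^^ n) ([], 0, 0, True)" for n
  define sg where "sg n = fst (st n)" for n
  define tg where "tg n = fst (snd (st n))" for n
  define ct where "ct n = fst (snd (snd (st n)))" for n
  define pa where "pa n = snd (snd (snd (st n)))" for n
  define t where "t n \<longleftrightarrow> branch (sg n) \<and> tg n \<le> length (sg n) \<and> pa n = b (ct n)" for n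
  define h where "h n = (if t n then sec (sg n) else lm (sg n))" for n
  have st0: "sg 0 = []" "ct 0 = 0" "pa 0"
    by (simp_all add: sg_def ct_def pa_def st_def)
  have "st n = (sg n, tg n, ct n, pa n)" for n
    by (simp add: sg_def tg_def ct_def pa_def)
  moreover have "st (Suc n) = step (st n)" for n
    by (simp add: st_def)
  ultimately have st: "st (Suc n) = (sg n @ [h n], if t n then max (tg n) (F (length (sg n))) else tg n,
    if t n then Suc (ct n) else ct n, if branch (sg n) then \<not> pa n else pa n)" for n
    by (simp add: step_def t_def h_def Let_def)
  have sg_Suc: "sg (Suc n) = sg n @ [h n]" for n
    using st by (simp add: sg_def)
  have sg: "sg n = pre h n" for n
    by (induction n) (simp_all add: st0 sg_Suc)
  have tg_Suc: "tg (Suc n) = (if t n then max (tg n) (F n) else tg n)" for n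
    using st[of n] by (simp add: tg_def sg)
  have ct_Suc: "ct (Suc n) = (if t n then Suc (ct n) else ct n)" for n
    using st[of n] by (simp add: ct_def)
  have pa_Suc: "pa (Suc n) = (if branch (sg n) then \<not> pa n else pa n)" for n
    using st[of n] by (simp add: pa_def)
  have h_t: "h n = sec (pre h n)" "branch (pre h n)" if "t n" for n
    using that h_def[of n] t_def[of n] by (simp_all add: sg)
  have h_nt: "h n = lm (pre h n)" if "\<not> t n" for n
    using that h_def[of n] by (simp add: sg)
  have S: "pre h n \<in> S" for n
  proof (induction n)
    case 0
    then show ?case using Nil by simp
  next
    case (Suc n)
    then show ?case
      using lm[of "pre h n"] sec(2)[of "pre h n"] h_t[of n] h_nt[of n] by (cases "t n") simp_all
  qed
  have mk: "t n \<longleftrightarrow> (\<exists>j<h n. pre h n @ [j] \<in> S)" for n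
  proof (cases "t n")
    case True
    then have "lm (pre h n) < h n"
      using lm_sec h_t[of n] by simp
    then show ?thesis
      using True lm[OF S] by blast
  next
    case False
    then show ?thesis
      using lm_le[of "pre h n"] h_nt[OF False] not_less by metis
  qed
  have br: "branch (pre h n) \<longleftrightarrow> (\<exists>j. j \<noteq> h n \<and> pre h n @ [j] \<in> S)" for n
  proof (cases "t n")
    case True
    then have "lm (pre h n) \<noteq> h n"
      using sec(1)[OF h_t(2)[OF True]] h_t(1)[OF True] by simp
    then show ?thesis
      using lm[OF S] h_t(2)[OF True] by blast
  next
    case False
    then show ?thesis
      using h_nt[OF False] by (simp add: branch_def)
  qed
  have ct: "ct n = card {m. m < n \<and> t m}" for n
  proof (induction n)
    case (Suc n)
    have "{m. m < Suc n \<and> t m} = (if t n then insert n {m. m < n \<and> t m} else {m. m < n \<and> t m})"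
      by (auto simp: less_Suc_eq)
    then show ?case
      using Suc by (simp add: ct_Suc)
  qed (simp add: st0)
  have pa: "pa n \<longleftrightarrow> even (card {m. m < n \<and> branch (pre h m)})" for n
  proof (induction n)
    case (Suc n)
    have "{m. m < Suc n \<and> branch (pre h m)} = (if branch (pre h n)
      then insert n {m. m < n \<and> branch (pre h m)} else {m. m < n \<and> branch (pre h m)})"
      by (auto simp: less_Suc_eq)
    then show ?case
      using Suc by (simp add: pa_Suc sg)
  qed (simp add: st0)
  \<comment> \<open>Of two incompatible extensions of \<open>pre h k\<close>, one is not on
    \<open>h\<close>; the place where it departs is a branching node at position \<open>k\<close> or
    later.\<close>
  have inf_branch: "\<exists>m\<ge>k. branch (pre h m)" for k
  proof -
    obtain u v where uv: "u \<in> S" "v \<in> S" "prefix (pre h k) u" "prefix (pre h k) v"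
      "\<not> prefix u v" "\<not> prefix v u"
      using split[OF S[of k]] by blast
    have "\<not> (u = pre h (length u) \<and> v = pre h (length v))"
    proof
      assume eq: "u = pre h (length u) \<and> v = pre h (length v)"
      have "prefix (pre h (length u)) (pre h (length v)) \<or> prefix (pre h (length v)) (pre h (length u))"
        unfolding prefix_pre_iff by (rule nat_le_linear)
      then show False
        using uv(5,6) eq by metis
    qed
    then obtain w where w: "w \<in> S" "prefix (pre h k) w" "w \<noteq> pre h (length w)"
      using uv by blast
    have "\<exists>m<length w. w ! m \<noteq> h m"
    proof (rule ccontr)
      assume "\<not> (\<exists>m<length w. w ! m \<noteq> h m)"
      then have "w = pre h (length w)"
        by (intro nth_equalityI) auto
      then show False
        using w(3) by blast
    qed
    then obtain m where m: "m < length w" "w ! m \<noteq> h m"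
      and least: "\<And>i. i < m \<Longrightarrow> \<not> (i < length w \<and> w ! i \<noteq> h i)"
      using exists_least_iff[of "\<lambda>m. m < length w \<and> w ! m \<noteq> h m"] by blast
    have "take m w = pre h m"
      using m(1) least by (auto simp: list_eq_iff_nth_eq)
    then have "take (Suc m) w = pre h m @ [w ! m]"
      using m(1) by (simp add: take_Suc_conv_app_nth)
    then have "pre h m @ [w ! m] \<in> S"
      using down[OF take_is_prefix[of "Suc m" w] w(1)] by simp
    moreover have "k \<le> m"
    proof (rule ccontr)
      assume "\<not> k \<le> m"
      then have "w ! m = h m"
        using w(2) by (auto simp: prefix_def nth_append)
      then show False using m(2) by simp
    qed
    ultimately show ?thesis
      using br m(2) by blast
  qed
  \<comment> \<open>Without further marks the bound and the bit stay fixed, but consecutive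
    branching nodes have opposite parities, so one of them would be a mark.\<close>
  have inf: "\<exists>m\<ge>n. t m" for n
  proof (rule ccontr)
    assume no: "\<not> (\<exists>m\<ge>n. t m)"
    have const: "tg m = tg n \<and> ct m = ct n" if "m \<ge> n" for m
      using that no by (induction m rule: dec_induct) (auto simp: tg_Suc ct_Suc)
    obtain m where m: "m \<ge> max n (tg n)" "branch (pre h m)"
      using inf_branch by blast
    define m' where "m' = (LEAST k. k > m \<and> branch (pre h k))"
    have ex: "\<exists>k. k > m \<and> branch (pre h k)"
      using inf_branch[of "Suc m"] Suc_le_eq by blast
    have m': "m' > m" "branch (pre h m')"
      unfolding m'_def using LeastI_ex[OF ex] by auto
    have least: "\<not> branch (pre h k)" if "m < k" "k < m'" for k
      using not_less_Least[of k "\<lambda>k. k > m \<and> branch (pre h k)"] that unfolding m'_def by blast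
    have "pa k = (\<not> pa m)" if "Suc m \<le> k" "k \<le> m'" for k
      using that
    proof (induction k rule: dec_induct)
      case base
      then show ?case using m by (simp add: pa_Suc sg)
    next
      case (step k)
      then show ?case using least[of k] by (simp add: pa_Suc sg)
    qed
    then have "pa m' = (\<not> pa m)"
      using m'(1) by simp
    moreover have "pa m \<noteq> b (ct n)"
      using no const[of m] m by (auto simp: t_def sg)
    moreover have "pa m' \<noteq> b (ct n)"
      using no const[of m'] m m' by (auto simp: t_def sg)
    ultimately show False
      by blast
  qed
  have tg_mono: "F m \<le> tg n" if "m < n" "t m" for m n
    using that(1)
  proof (induction n)
    case (Suc n)
    then show ?case
      using that(2) by (cases "m = n") (auto simp: tg_Suc)
  qed simp
  show thesis
  proof (rule that[of h t "\<lambda>n. branch (pre h n)"])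
    show "F m \<le> n" if "m < n" "t m" "t n" for m n
      using tg_mono[OF that(1,2)] that(3) by (auto simp: t_def sg)
    show "b (card {m. m < n \<and> t m}) \<longleftrightarrow> even (card {m. m < n \<and> branch (pre h m)})" if "t n" for n
      using that t_def[of n] by (simp only: ct[symmetric] pa[symmetric])
  qed (use S mk br inf in auto)
qed

section \<open>Trees and their branches\<close>

definition split_pair :: "nat \<Rightarrow> nat \<Rightarrow> nat \<Rightarrow> bool" where
  "split_pair s u v \<longleftrightarrow> prefix (list_decode s) (list_decode u) \<and> prefix (list_decode s) (list_decode v) \<and>
     \<not> prefix (list_decode u) (list_decode v) \<and> \<not> prefix (list_decode v) (list_decode u)"

definition left_sibling :: "nat list \<Rightarrow> nat list \<Rightarrow> bool" where
  "left_sibling \<rho> \<sigma> \<longleftrightarrow> (\<exists>\<tau> i j. \<rho> = \<tau> @ [i] \<and> \<sigma> = \<tau> @ [j] \<and> i < j)"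

definition bools_decode :: "nat \<Rightarrow> bool list" where
  "bools_decode c = map odd (list_decode c)"

lemma bools_decode_surj: "\<exists>c. bools_decode c = l"
  by (rule exI[of _ "list_encode (map of_bool l)"]) (simp add: bools_decode_def o_def)

text \<open>One oracle tabulates all the combinatorial relations that the formulas below refer to, so
  that no coding of finite sequences inside arithmetic is needed.\<close>

definition table :: "(bool list \<Rightarrow> nat list \<Rightarrow> bool) \<Rightarrow> nat \<Rightarrow> nat \<Rightarrow> nat \<Rightarrow> nat \<Rightarrow> bool" where
  "table Q k s u v \<longleftrightarrow>
     (if k = 0 then split_pair s u v
      else if k = 2 then prefix (list_decode s) (list_decode u)
      else if k = 3 then left_sibling (list_decode s) (list_decode u)
      else if k = 4 then length (list_decode s) = u
      else if k = 5 then u < length (list_decode s) \<and> odd (list_decode s ! u)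
      else if k = 6 then u < length (list_decode s) \<and> even (list_decode s ! u)
      else if k = 7 then length (bools_decode s) = length (list_decode u) \<and> Q (bools_decode s) (list_decode u)
      else if k = 8 then u < length (bools_decode s) \<and> bools_decode s ! u
      else u < length (bools_decode s) \<and> \<not> bools_decode s ! u)"

definition oracle_of :: "(bool list \<Rightarrow> nat list \<Rightarrow> bool) \<Rightarrow> cantor" where
  "oracle_of Q n \<longleftrightarrow> (\<exists>k s u v. n = pr k (pr s (pr u v)) \<and> table Q k s u v)"

lemma oracle_of_pr [simp]: "oracle_of Q (pr k (pr s (pr u v))) \<longleftrightarrow> table Q k s u v"
  by (auto simp: oracle_of_def)

lemma table_simps [simp]:
  "table Q 0 s u v \<longleftrightarrow> split_pair s u v"
  "table Q 2 s u v \<longleftrightarrow> prefix (list_decode s) (list_decode u)"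
  "table Q 3 s u v \<longleftrightarrow> left_sibling (list_decode s) (list_decode u)"
  "table Q 4 s u v \<longleftrightarrow> length (list_decode s) = u"
  "table Q 5 s u v \<longleftrightarrow> u < length (list_decode s) \<and> odd (list_decode s ! u)"
  "table Q 6 s u v \<longleftrightarrow> u < length (list_decode s) \<and> even (list_decode s ! u)"
  "table Q 7 s u v \<longleftrightarrow>
     length (bools_decode s) = length (list_decode u) \<and> Q (bools_decode s) (list_decode u)"
  "table Q 8 s u v \<longleftrightarrow> u < length (bools_decode s) \<and> bools_decode s ! u"
  "table Q 9 s u v \<longleftrightarrow> u < length (bools_decode s) \<and> \<not> bools_decode s ! u"
  by (simp_all add: table_def)

definition FTab :: "nat \<Rightarrow> nterm \<Rightarrow> nterm \<Rightarrow> nterm \<Rightarrow> arith_fm" where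
  "FTab k s u v = FMem (npr (nnum k) (npr s (npr u v))) 2"

text \<open>The second equation, for arbitrary set values, serves the closedness proofs.\<close>

lemma arith_sat_FTab [simp]:
  "arith_sat e (env6 b X (oracle_of Q) c2 c3 c4) (FTab k s u v) \<longleftrightarrow>
     table Q k (nterm_val e s) (nterm_val e u) (nterm_val e v)"
  "arith_sat e S (FTab k s u v) \<longleftrightarrow> S 2 (pr k (pr (nterm_val e s) (pr (nterm_val e u) (nterm_val e v))))"
  by (simp_all add: FTab_def)

definition tree :: "(bool list \<Rightarrow> nat list \<Rightarrow> bool) \<Rightarrow> cantor \<Rightarrow> nat \<Rightarrow> bool" where
  "tree Q z s \<longleftrightarrow> (\<forall>\<sigma>. prefix \<sigma> (list_decode s) \<longrightarrow> Q (pre z (length \<sigma>)) \<sigma>)"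

lemma hyp_tree:
  assumes "hyp (oracle_of Q) v" "hyp z v"
  shows "hyp (tree Q z) v"
proof -
  \<comment> \<open>The initial segment of \<open>z\<close> is guessed through a code in variable 2;
    tables 8 and 9 compare it with \<open>z\<close> bit by bit, and table 7 checks its length and
    \<open>Q\<close>.\<close>
  define \<phi> where "\<phi> = FAll 1 (FImp (FTab 2 (NVar 1) (NVar 0) NZero)
    (FEx 2 (FAnd (FTab 7 (NVar 2) (NVar 1) NZero)
      (FAll 3 (FAnd (FImp (FTab 8 (NVar 2) (NVar 3) NZero) (FMem (NVar 3) 3))
                    (FImp (FTab 9 (NVar 2) (NVar 3) NZero) (FNeg (FMem (NVar 3) 3))))))))"
  show ?thesis
  proof (rule hyp_comprehension[OF assms assms, where \<phi> = \<phi>])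
    show "closed_fm (FAll 0 (FIff (FMem (NVar 0) 0) \<phi>))"
      by (simp add: closed_fm_def \<phi>_def)
    fix e X b' n
    have *: "(\<exists>c. length (bools_decode c) = length \<sigma> \<and> Q (bools_decode c) \<sigma> \<and>
        (\<forall>i. (i < length (bools_decode c) \<and> bools_decode c ! i \<longrightarrow> z i) \<and>
             (i < length (bools_decode c) \<and> \<not> bools_decode c ! i \<longrightarrow> \<not> z i)))
      \<longleftrightarrow> Q (pre z (length \<sigma>)) \<sigma>" (is "?L \<longleftrightarrow> ?R") for \<sigma>
    proof
      assume ?L
      then obtain c where c: "length (bools_decode c) = length \<sigma>" "Q (bools_decode c) \<sigma>"
        "\<And>i. i < length \<sigma> \<Longrightarrow> bools_decode c ! i = z i"
        by metis
      have "bools_decode c = pre z (length \<sigma>)"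
        by (rule nth_equalityI) (simp_all add: c(1,3))
      then show ?R using c(2) by simp
    next
      assume ?R
      obtain c where "bools_decode c = pre z (length \<sigma>)"
        using bools_decode_surj by blast
      then show ?L
        using \<open>?R\<close> by (intro exI[of _ c]) auto
    qed
    show "arith_sat (e(0 := n)) (env6 b' X (oracle_of Q) z (oracle_of Q) z) \<phi> \<longleftrightarrow> tree Q z n"
      by (simp add: \<phi>_def * conj_assoc tree_def)
        (metis list_encode_inverse)
  qed
qed

text \<open>By \<open>rank_order_unique\<close> the stage order is the only solution of the
  arithmetical clauses; the first conjunct excludes numbers that code no pair.\<close>

lemma hyp_stage_less:
  assumes hyps: "hyp (oracle_of Q) v" "hyp T v" and ker: "\<And>s. \<not> kernel T split_pair s"
  shows "hyp (\<lambda>n. \<exists>u s. n = pr u s \<and> stage_less T split_pair u s) v" (is "hyp ?b v")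
proof -
  define L where "L i j = FMem (npr (NVar i) (NVar j)) 0" for i j
  define P where "P = FTab 0 (NVar 0) (NVar 1) (NVar 2)"
  define \<phi> where "\<phi> =
    FAnd (FAll 0 (FImp (FMem (NVar 0) 0) (FEx 1 (FEx 2 (FEq (NVar 0) (npr (NVar 1) (NVar 2)))))))
    (FAnd (FAll 0 (FAll 1 (FAll 2 (FImp (L 0 1) (FOr (L 0 2) (L 2 1))))))
    (FAnd (FAll 0 (FAll 1 (FAll 2 (FImp (FAnd (FMem (NVar 0) 3) P) (FOr (L 1 0) (L 2 0))))))
     (FAll 3 (FAll 0 (FImp (L 3 0) (FAnd (FMem (NVar 0) 3)
        (FEx 1 (FEx 2 (FAnd P (FAnd (FNeg (L 1 3)) (FNeg (L 2 3))))))))))))"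
  have \<phi>: "holds (env6 b' X (oracle_of Q) T T T) \<phi> \<longleftrightarrow> (\<forall>n. b' n \<longrightarrow> (\<exists>u s. n = pr u s)) \<and>
    rank_order T split_pair (\<lambda>u s. b' (pr u s))" for b' X
    by (simp add: \<phi>_def L_def P_def rank_order_def)
  show ?thesis
  proof (rule hyp_definable[OF hyps(1,2,2,2), where \<phi> = \<phi>])
    show "closed_fm \<phi>"
      by (simp add: closed_fm_def \<phi>_def L_def P_def)
    show "\<exists>X. holds (env6 ?b X (oracle_of Q) T T T) \<phi>"
      unfolding \<phi> using rank_order_stage_less[OF ker] by auto
    fix b' X assume "holds (env6 b' X (oracle_of Q) T T T) \<phi>"
    then have b': "\<And>n. b' n \<Longrightarrow> \<exists>u s. n = pr u s" "rank_order T split_pair (\<lambda>u s. b' (pr u s))"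
      unfolding \<phi> by blast+
    have "(\<lambda>u s. b' (pr u s)) = stage_less T split_pair"
      by (rule rank_order_unique[OF wfp_stage_less[OF ker] rank_order_stage_less[OF ker] b'(2)])
    then have "b' (pr u s) \<longleftrightarrow> stage_less T split_pair u s" for u s
      by (metis (no_types))
    then show "b' = ?b"
      using b'(1) by (intro ext) metis
  qed
qed

text \<open>The effective perfect set theorem: without a perfect kernel, a branch is isolated among the
  nodes whose rank is at least the eventual rank of its initial segments.\<close>

lemma hyp_branch_if_no_kernel:
  assumes hyps: "hyp (oracle_of Q) v" "hyp T v" and ker: "\<And>s. \<not> kernel T split_pair s"
    and \<beta>: "\<And>n. T (list_encode (pre \<beta> n))"
  shows "hyp (\<lambda>i. odd (\<beta> i)) v"
proof -
  define L where "L = stage_less T split_pair"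
  have L: "rank_order T split_pair L" "wfp L"
    unfolding L_def using rank_order_stage_less wfp_stage_less ker by blast+
  have "\<exists>z\<in>range (\<lambda>n. list_encode (pre \<beta> n)). \<forall>y. L y z \<longrightarrow> y \<notin> range (\<lambda>n. list_encode (pre \<beta> n))"
    using L(2)[unfolded wfp_iff_ex_minimal] by blast
  \<comment> \<open>An initial segment of \<open>\<beta>\<close> of least rank.\<close>
  then obtain m where m: "\<And>n. \<not> L (list_encode (pre \<beta> n)) (list_encode (pre \<beta> m))"
    by blast
  define s where "s = list_encode (pre \<beta> m)"
  \<comment> \<open>Otherwise \<open>u\<close> and the initial segment of \<open>\<beta>\<close> of
    the same length split \<open>s\<close>, so one of them would have smaller rank than
    \<open>s\<close>.\<close>
  have on: "list_decode u = pre \<beta> (length (list_decode u))"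
    if "prefix (pre \<beta> m) (list_decode u)" "\<not> L u s" for u
  proof (rule ccontr)
    define w where "w = list_encode (pre \<beta> (length (list_decode u)))"
    assume ne: "list_decode u \<noteq> pre \<beta> (length (list_decode u))"
    have "prefix (pre \<beta> m) (pre \<beta> (length (list_decode u)))"
      unfolding prefix_pre_iff using prefix_length_le[OF that(1)] by simp
    moreover have eq: "\<sigma> = \<tau>" if "prefix \<sigma> \<tau>" "length \<sigma> = length \<tau>" for \<sigma> \<tau> :: "nat list"
      using that by (auto simp: prefix_def)
    have "\<not> prefix (list_decode u) (pre \<beta> (length (list_decode u)))"
      "\<not> prefix (pre \<beta> (length (list_decode u))) (list_decode u)"
      using ne eq[of "list_decode u" "pre \<beta> (length (list_decode u))"]
        eq[of "pre \<beta> (length (list_decode u))" "list_decode u"] by auto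
    ultimately have "split_pair s u w"
      using that(1) by (simp add: split_pair_def s_def w_def)
    moreover have "T s"
      using \<beta> by (simp add: s_def)
    ultimately have "L u s \<or> L w s"
      using L(1) unfolding rank_order_def by blast
    then show False
      using that(2) m by (simp add: s_def w_def)
  qed
  define \<phi> where "\<phi> = FEx 1 (FAnd (FTab 2 (nnum s) (NVar 1) NZero)
    (FAnd (FNeg (FMem (npr (NVar 1) (nnum s)) 3)) (FTab 5 (NVar 1) (NVar 0) NZero)))"
  show ?thesis
  proof (rule hyp_comprehension[OF hyps(1) hyp_stage_less[OF hyps ker] hyps, where \<phi> = \<phi>])
    show "closed_fm (FAll 0 (FIff (FMem (NVar 0) 0) \<phi>))"
      by (simp add: closed_fm_def \<phi>_def)
    fix e X b' i
    have "(\<exists>u. prefix (list_decode s) (list_decode u) \<and> \<not> L u s \<and> i < length (list_decode u) \<and>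
      odd (list_decode u ! i)) \<longleftrightarrow> odd (\<beta> i)" (is "?L \<longleftrightarrow> ?R")
    proof
      assume ?L
      then obtain u where u: "prefix (list_decode s) (list_decode u)" "\<not> L u s"
        "i < length (list_decode u)" "odd (list_decode u ! i)"
        by blast
      then have "list_decode u = pre \<beta> (length (list_decode u))"
        by (intro on) (auto simp: s_def)
      then have "list_decode u ! i = \<beta> i"
        using u(3) by (metis add.left_neutral diff_zero length_upt nth_map nth_upt)
      then show ?R
        using u(4) by simp
    next
      assume ?R
      then show ?L
        using m by (intro exI[of _ "list_encode (pre \<beta> (max m (Suc i)))"])
          (auto simp: s_def prefix_pre_iff)
    qed
    then show "arith_sat (e(0 := i)) (env6 b' X (oracle_of Q)
        (\<lambda>n. \<exists>u s. n = pr u s \<and> stage_less T split_pair u s) (oracle_of Q) T) \<phi> \<longleftrightarrow> odd (\<beta> i)"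
      by (simp add: \<phi>_def L_def)
  qed
qed

definition prefix_set :: "(nat \<Rightarrow> nat) \<Rightarrow> cantor" where
  "prefix_set \<beta> u \<longleftrightarrow> (\<exists>m. list_decode u = pre \<beta> m)"

text \<open>Recovers a whole branch from the point it codes. By \<open>uniq\<close> its initial
  segments form the only chain of nodes of \<open>T\<close> that has these parities and contains
  every length.\<close>

lemma hyp_prefix_set:
  assumes hyps: "hyp (oracle_of Q) v" "hyp T v" "hyp (\<lambda>i. odd (\<beta> i)) v"
    and \<beta>: "\<And>n. T (list_encode (pre \<beta> n))"
    and uniq: "\<And>\<gamma>. (\<And>n. T (list_encode (pre \<gamma> n))) \<Longrightarrow> (\<And>i. odd (\<gamma> i) = odd (\<beta> i)) \<Longrightarrow> \<gamma> = \<beta>"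
  shows "hyp (prefix_set \<beta>) v"
proof -
  define y where "y i = odd (\<beta> i)" for i
  define \<phi> where "\<phi> =
    FAnd (FAll 0 (FImp (FMem (NVar 0) 0) (FAnd (FMem (NVar 0) 3) (FAnd
      (FAll 1 (FImp (FMem (NVar 1) 0) (FOr (FTab 2 (NVar 0) (NVar 1) NZero) (FTab 2 (NVar 1) (NVar 0) NZero))))
      (FAll 1 (FAnd (FImp (FTab 5 (NVar 0) (NVar 1) NZero) (FMem (NVar 1) 4))
                    (FImp (FTab 6 (NVar 0) (NVar 1) NZero) (FNeg (FMem (NVar 1) 4)))))))))
    (FAll 0 (FEx 1 (FAnd (FMem (NVar 1) 0) (FTab 4 (NVar 1) (NVar 0) NZero))))"
  have \<phi>: "holds (env6 b' X (oracle_of Q) T y y) \<phi> \<longleftrightarrow>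
    (\<forall>u. b' u \<longrightarrow> T u \<and>
      (\<forall>w. b' w \<longrightarrow> prefix (list_decode u) (list_decode w) \<or> prefix (list_decode w) (list_decode u)) \<and>
      (\<forall>i. (i < length (list_decode u) \<and> odd (list_decode u ! i) \<longrightarrow> y i) \<and>
           (i < length (list_decode u) \<and> even (list_decode u ! i) \<longrightarrow> \<not> y i))) \<and>
    (\<forall>n. \<exists>u. b' u \<and> length (list_decode u) = n)" for b' X
    by (simp add: \<phi>_def)
  have "hyp y v"
    using hyps(3) by (simp add: y_def[abs_def])
  show ?thesis
  proof (rule hyp_definable[OF hyps(1,2) \<open>hyp y v\<close> \<open>hyp y v\<close>, where \<phi> = \<phi>])
    show "closed_fm \<phi>"
      by (simp add: closed_fm_def \<phi>_def)
    have "T u" if "prefix_set \<beta> u" for u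
      using that \<beta> unfolding prefix_set_def by (metis list_decode_inverse)
    moreover have "prefix (list_decode u) (list_decode w) \<or> prefix (list_decode w) (list_decode u)"
      if "prefix_set \<beta> u" "prefix_set \<beta> w" for u w
      using that unfolding prefix_set_def by (metis prefix_pre_iff nat_le_linear)
    moreover have "odd (list_decode u ! i) \<longleftrightarrow> y i" if "prefix_set \<beta> u" "i < length (list_decode u)" for u i
      using that unfolding prefix_set_def y_def by auto
    moreover have "\<exists>u. prefix_set \<beta> u \<and> length (list_decode u) = n" for n
      by (rule exI[of _ "list_encode (pre \<beta> n)"]) (auto simp: prefix_set_def)
    ultimately show "\<exists>X. holds (env6 (prefix_set \<beta>) X (oracle_of Q) T y y) \<phi>"
      unfolding \<phi> by blast
    fix b' X assume "holds (env6 b' X (oracle_of Q) T y y) \<phi>"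
    then have T: "\<And>u. b' u \<Longrightarrow> T u"
      and cmp: "\<And>u w. b' u \<Longrightarrow> b' w \<Longrightarrow>
        prefix (list_decode u) (list_decode w) \<or> prefix (list_decode w) (list_decode u)"
      and y: "\<And>u i. b' u \<Longrightarrow> i < length (list_decode u) \<Longrightarrow> odd (list_decode u ! i) \<longleftrightarrow> y i"
      and len: "\<forall>n. \<exists>u. b' u \<and> length (list_decode u) = n"
      unfolding \<phi> by blast+
    obtain U where U: "\<And>n. b' (U n)" "\<And>n. length (list_decode (U n)) = n"
      using len by metis
    define \<gamma> where "\<gamma> i = list_decode (U (Suc i)) ! i" for i
    have dec: "list_decode u = pre \<gamma> (length (list_decode u))" if "b' u" for u
    proof (rule nth_equalityI)
      fix i assume i: "i < length (list_decode u)"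
      then have "list_decode u ! i = list_decode (U (Suc i)) ! i"
        using cmp[OF that U(1)[of "Suc i"]] U(2)[of "Suc i"] by (auto simp: prefix_def nth_append)
      then show "list_decode u ! i = pre \<gamma> (length (list_decode u)) ! i"
        using i by (simp add: \<gamma>_def)
    qed simp
    have Un: "U n = list_encode (pre \<gamma> n)" for n
      using dec[OF U(1), of n] U(2)[of n] by (metis list_decode_inverse)
    have "\<gamma> = \<beta>"
    proof (rule uniq)
      show "T (list_encode (pre \<gamma> n))" for n
        using T[OF U(1)[of n]] by (simp add: Un)
      show "odd (\<gamma> i) = odd (\<beta> i)" for i
        using y[OF U(1)[of "Suc i"], of i] U(2)[of "Suc i"] by (simp add: \<gamma>_def y_def)
    qed
    show "b' = prefix_set \<beta>"
    proof (intro ext iffI)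
      fix u assume "b' u"
      then show "prefix_set \<beta> u"
        using dec \<open>\<gamma> = \<beta>\<close> unfolding prefix_set_def by blast
    next
      fix u assume "prefix_set \<beta> u"
      then obtain m where "list_decode u = pre \<beta> m"
        unfolding prefix_set_def by blast
      then have "u = U m"
        unfolding Un \<open>\<gamma> = \<beta>\<close> by (metis list_decode_inverse)
      then show "b' u"
        using U(1) by simp
    qed
  qed
qed

section \<open>Recovering the kernel from a branch\<close>

definition mark :: "(nat \<Rightarrow> nat) \<Rightarrow> cantor \<Rightarrow> nat \<Rightarrow> bool" where
  "mark h K n \<longleftrightarrow> (\<exists>w \<rho>. prefix_set h w \<and> length (list_decode w) = Suc n \<and>
     left_sibling (list_decode \<rho>) (list_decode w) \<and> K \<rho>)"

text \<open>\<open>within_marks h K s u\<close> says that \<open>u\<close> is at most the second mark from \<open>s\<close> on. This bound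
  grows when \<open>K\<close> shrinks, which is why the kernel is the only solution of the fixed-point equation
  in \<open>hyp_kernel\<close>: every solution is contained in the kernel, so its bounds are large enough.\<close>

definition within_marks :: "(nat \<Rightarrow> nat) \<Rightarrow> cantor \<Rightarrow> nat \<Rightarrow> nat \<Rightarrow> bool" where
  "within_marks h K s u \<longleftrightarrow> \<not> (\<exists>m n. s \<le> m \<and> m < n \<and> n < u \<and> mark h K m \<and> mark h K n)"

text \<open>Set variable 0 is the unknown kernel and 4 the path. Number variables 10 and 11 keep
  clear of the indices of the callers.\<close>

definition FMark :: "nat \<Rightarrow> arith_fm" where
  "FMark i = FEx 10 (FEx 11 (FAnd (FMem (NVar 10) 4) (FAnd (FTab 4 (NVar 10) (NSuc (NVar i)) NZero)
     (FAnd (FTab 3 (NVar 11) (NVar 10) NZero) (FMem (NVar 11) 0)))))"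

lemma arith_sat_FMark:
  "i < 10 \<Longrightarrow> arith_sat e (env6 K X (oracle_of Q) T (prefix_set h) c4) (FMark i) \<longleftrightarrow> mark h K (e i)"
  by (simp add: FMark_def mark_def)

text \<open>The witness \<open>X\<close> tabulates the bounded derivatives, which makes the
  fixed-point equation arithmetical. Requiring unboundedly many marks makes the bounds finite, so
  \<open>perfect_bounded_deriv\<close> puts every solution inside the kernel.\<close>

lemma hyp_kernel:
  fixes T :: cantor
  defines "K \<equiv> kernel T split_pair"
  assumes hyps: "hyp (oracle_of Q) v" "hyp T v" "hyp (prefix_set h) v"
    and inf: "\<And>n. \<exists>m\<ge>n. mark h K m"
    and bd: "\<And>s. K s \<Longrightarrow> \<exists>u v. split_pair s u v \<and> K u \<and> K v \<and> within_marks h K s u \<and> within_marks h K s v"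
  shows "hyp K v"
proof -
  define D where "D = bounded_deriv T split_pair"
  define FB where "FB i j = FNeg (FEx 6 (FEx 7 (FAnd (FNeg (FLess (NVar 6) (NVar i)))
    (FAnd (FLess (NVar 6) (NVar 7)) (FAnd (FLess (NVar 7) (NVar j)) (FAnd (FMark 6) (FMark 7)))))))" for i j
  define FD where "FD n s = FMem (npr n s) 1" for n s
  define \<phi> where "\<phi> =
    FAnd (FAll 0 (FEx 1 (FAnd (FNeg (FLess (NVar 1) (NVar 0))) (FMark 1))))
    (FAnd (FAll 0 (FIff (FD NZero (NVar 0)) (FMem (NVar 0) 3)))
    (FAnd (FAll 1 (FAll 0 (FIff (FD (NSuc (NVar 1)) (NVar 0)) (FAnd (FD (NVar 1) (NVar 0))
      (FEx 2 (FEx 3 (FAnd (FTab 0 (NVar 0) (NVar 2) (NVar 3)) (FAnd (FB 0 2) (FAnd (FB 0 3)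
        (FAnd (FD (NVar 1) (NVar 2)) (FD (NVar 1) (NVar 3))))))))))))
     (FAll 0 (FIff (FMem (NVar 0) 0) (FAll 1 (FD (NVar 1) (NVar 0)))))))"
  have FB: "arith_sat e (env6 K' X (oracle_of Q) T (prefix_set h) T) (FB i j) \<longleftrightarrow>
    within_marks h K' (e i) (e j)" if "i < 6" "j < 6" for e K' X i j
    using that by (simp add: FB_def within_marks_def arith_sat_FMark not_less)
  have \<phi>: "holds (env6 K' X (oracle_of Q) T (prefix_set h) T) \<phi> \<longleftrightarrow>
    (\<forall>n. \<exists>m\<ge>n. mark h K' m) \<and> (\<forall>s. X (pr 0 s) \<longleftrightarrow> T s) \<and>
    (\<forall>n s. X (pr (Suc n) s) \<longleftrightarrow> X (pr n s) \<and> (\<exists>u v. split_pair s u v \<and> within_marks h K' s u \<and>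
       within_marks h K' s v \<and> X (pr n u) \<and> X (pr n v))) \<and>
    (\<forall>s. K' s \<longleftrightarrow> (\<forall>n. X (pr n s)))" for K' X
    by (simp add: \<phi>_def FD_def FB arith_sat_FMark not_less)
  show ?thesis
  proof (rule hyp_definable[OF hyps hyps(2), where \<phi> = \<phi>])
    show "closed_fm \<phi>"
      by (simp add: closed_fm_def \<phi>_def FD_def FB_def FMark_def)
    have le: "kernel T split_pair s \<Longrightarrow> D (within_marks h K') n s"
      if "\<And>s u. within_marks h K s u \<Longrightarrow> within_marks h K' s u" for K' n s
      unfolding D_def by (rule kernel_imp_bounded_deriv) (use bd that K_def in blast)+
    have ge: "kernel T split_pair s" if marks: "\<And>n. \<exists>m\<ge>n. mark h K' m"
      and s: "\<And>n. D (within_marks h K') n s" for K' s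
    proof (rule perfect_imp_kernel[OF perfect_bounded_deriv])
      show "\<forall>n. bounded_deriv T split_pair (within_marks h K') n s"
        using s by (simp add: D_def)
      fix r
      obtain m where "m \<ge> r" "mark h K' m"
        using marks by blast
      moreover obtain n where "n \<ge> Suc m" "mark h K' n"
        using marks by blast
      ultimately show "\<exists>m. \<forall>u. within_marks h K' r u \<longrightarrow> u \<le> m"
        unfolding within_marks_def by (metis Suc_le_eq not_le)
    qed
    show "\<exists>X. holds (env6 K X (oracle_of Q) T (prefix_set h) T) \<phi>"
    proof -
      define X where "X k \<longleftrightarrow> (\<exists>n s. k = pr n s \<and> D (within_marks h K) n s)" for k
      have X: "X (pr n s) \<longleftrightarrow> D (within_marks h K) n s" for n s
        by (simp add: X_def)
      have "K s \<longleftrightarrow> (\<forall>n. D (within_marks h K) n s)" for s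
        using le[of K] ge[of K, OF inf] unfolding K_def by blast
      then show ?thesis
        unfolding \<phi> using inf by (intro exI[of _ X]) (simp add: X, simp add: D_def)
    qed
    fix K' X assume "holds (env6 K' X (oracle_of Q) T (prefix_set h) T) \<phi>"
    then have marks: "\<And>n. \<exists>m\<ge>n. mark h K' m" and X0: "\<And>s. X (pr 0 s) \<longleftrightarrow> T s"
      and XS: "\<And>n s. X (pr (Suc n) s) \<longleftrightarrow> X (pr n s) \<and> (\<exists>u v. split_pair s u v \<and>
        within_marks h K' s u \<and> within_marks h K' s v \<and> X (pr n u) \<and> X (pr n v))"
      and K': "\<And>s. K' s \<longleftrightarrow> (\<forall>n. X (pr n s))"
      unfolding \<phi> by blast+
    have X: "X (pr n s) \<longleftrightarrow> D (within_marks h K') n s" for n s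
      by (induction n arbitrary: s) (simp_all add: D_def X0 XS)
    have sub: "K s" if "K' s" for s
      unfolding K_def using ge[of K' s, OF marks] that K' X by blast
    have "within_marks h K' s u" if "within_marks h K s u" for s u
      using that sub unfolding within_marks_def mark_def by meson
    then have "K' s" if "K s" for s
      using le[of K' s] that K' X unfolding K_def by blast
    with sub show "K' = K"
      by blast
  qed
qed

section \<open>Reading the coded bits off the marks\<close>

lemma hyp_count:
  assumes "hyp A v"
  shows "hyp (\<lambda>k. \<exists>n i. k = pr n i \<and> card {m. m < n \<and> A m} = i) v" (is "hyp ?b v")
proof -
  define \<phi> where "\<phi> =
    FAnd (FAll 0 (FImp (FMem (NVar 0) 0) (FEx 1 (FEx 2 (FEq (NVar 0) (npr (NVar 1) (NVar 2)))))))
    (FAnd (FAll 2 (FIff (FMem (npr NZero (NVar 2)) 0) (FEq (NVar 2) NZero)))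
     (FAll 1 (FAll 2 (FIff (FMem (npr (NSuc (NVar 1)) (NVar 2)) 0)
       (FOr (FAnd (FMem (NVar 1) 2) (FEx 3 (FAnd (FEq (NVar 2) (NSuc (NVar 3))) (FMem (npr (NVar 1) (NVar 3)) 0))))
            (FAnd (FNeg (FMem (NVar 1) 2)) (FMem (npr (NVar 1) (NVar 2)) 0)))))))"
  have \<phi>: "holds (env6 b' X A A A A) \<phi> \<longleftrightarrow> (\<forall>k. b' k \<longrightarrow> (\<exists>n i. k = pr n i)) \<and>
    (\<forall>i. b' (pr 0 i) \<longleftrightarrow> i = 0) \<and>
    (\<forall>n i. b' (pr (Suc n) i) \<longleftrightarrow> A n \<and> (\<exists>j. i = Suc j \<and> b' (pr n j)) \<or> \<not> A n \<and> b' (pr n i))" for b' X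
    by (simp add: \<phi>_def)
  have card: "card {m. m < Suc n \<and> A m} = (if A n then Suc (card {m. m < n \<and> A m})
    else card {m. m < n \<and> A m})" for n
  proof -
    have "{m. m < Suc n \<and> A m} = (if A n then insert n {m. m < n \<and> A m} else {m. m < n \<and> A m})"
      by (auto simp: less_Suc_eq)
    then show ?thesis by simp
  qed
  show ?thesis
  proof (rule hyp_definable[OF assms assms assms assms, where \<phi> = \<phi>])
    show "closed_fm \<phi>"
      by (simp add: closed_fm_def \<phi>_def)
    show "\<exists>X. holds (env6 ?b X A A A A) \<phi>"
      unfolding \<phi> by (auto simp: card)
    fix b' X assume b': "holds (env6 b' X A A A A) \<phi>"
    have "b' (pr n i) \<longleftrightarrow> card {m. m < n \<and> A m} = i" for n i
      using b' unfolding \<phi> by (induction n arbitrary: i) (auto simp: card)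
    then show "b' = ?b"
      using b' unfolding \<phi> by (intro ext) metis
  qed
qed

lemma hyp_marks_branchings:
  assumes hyps: "hyp (oracle_of Q) v" "hyp K v" "hyp (prefix_set h) v"
  shows "hyp (mark h K) v" (is ?A)
    and "hyp (\<lambda>n. \<exists>w \<rho>. prefix_set h w \<and> length (list_decode w) = Suc n \<and>
      (left_sibling (list_decode \<rho>) (list_decode w) \<or> left_sibling (list_decode w) (list_decode \<rho>)) \<and>
      K \<rho>) v" (is ?B)
proof -
  define \<phi> where "\<phi> r = FEx 1 (FEx 2 (FAnd (FMem (NVar 1) 4) (FAnd (FTab 4 (NVar 1) (NSuc (NVar 0)) NZero)
     (FAnd r (FMem (NVar 2) 3)))))" for r
  define L where "L i j = FTab 3 (NVar i) (NVar j) NZero" for i j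
  show ?A
    by (rule hyp_comprehension[OF hyps hyps(1), where \<phi> = "\<phi> (L 2 1)"])
      (simp_all add: closed_fm_def \<phi>_def L_def mark_def)
  show ?B
    by (rule hyp_comprehension[OF hyps hyps(1), where \<phi> = "\<phi> (FOr (L 2 1) (L 1 2))"])
      (simp_all add: closed_fm_def \<phi>_def L_def)
qed

lemma exists_nth_mark:
  assumes "\<And>n. \<exists>m\<ge>n. mk m"
  shows "\<exists>n::nat. mk n \<and> card {m. m < n \<and> mk m} = i"
proof -
  have "infinite {m. mk m}"
    unfolding infinite_nat_iff_unbounded_le using assms by blast
  then have inf: "infinite (Collect mk)" by simp
  have "mk (enumerate (Collect mk) i)"
    using enumerate_in_set[OF inf, of i] by simp
  moreover have "{m. m < enumerate (Collect mk) i \<and> mk m} = enumerate (Collect mk) ` {..<i}"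
  proof (intro equalityI subsetI)
    fix m assume m: "m \<in> {m. m < enumerate (Collect mk) i \<and> mk m}"
    then obtain j where "m = enumerate (Collect mk) j"
      using enumerate_Ex[of "Collect mk" m] inf by auto
    then show "m \<in> enumerate (Collect mk) ` {..<i}"
      using m enumerate_mono_iff[OF inf] by auto
  next
    fix m assume "m \<in> enumerate (Collect mk) ` {..<i}"
    then show "m \<in> {m. m < enumerate (Collect mk) i \<and> mk m}"
      using enumerate_mono_iff[OF inf] enumerate_in_set[OF inf] by auto
  qed
  then have "card {m. m < enumerate (Collect mk) i \<and> mk m} = i"
    using strict_mono_enumerate[OF inf]
    by (simp add: card_image strict_mono_on_imp_inj_on inj_on_subset[OF _ subset_UNIV])
  ultimately show ?thesis by blast
qed

lemma tree_downward: "tree Q z s \<Longrightarrow> prefix (list_decode r) (list_decode s) \<Longrightarrow> tree Q z r"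
  unfolding tree_def using prefix_order.trans by blast

lemma left_sibling_pre:
  "left_sibling \<rho> (pre h (Suc n)) \<longleftrightarrow> (\<exists>j<h n. \<rho> = pre h n @ [j])"
  "left_sibling (pre h (Suc n)) \<rho> \<longleftrightarrow> (\<exists>j>h n. \<rho> = pre h n @ [j])"
  by (auto simp: left_sibling_def)

lemma prefix_set_length: "prefix_set h w \<and> length (list_decode w) = n \<longleftrightarrow> list_decode w = pre h n"
  by (auto simp: prefix_set_def)

text \<open>Martin's theorem on uncountable hyperarithmetic sets, in the form needed here.\<close>

lemma kernel_codes:
  assumes ker: "kernel (tree Q z) split_pair s0"
  obtains h where "\<And>n. tree Q z (list_encode (pre h n))"
    "\<And>v. hyp (oracle_of Q) v \<Longrightarrow> hyp (tree Q z) v \<Longrightarrow> hyp (prefix_set h) v \<Longrightarrow> hyp b v"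
proof -
  define T where "T = tree Q z"
  define K where "K = kernel T split_pair"
  have perf: "K s \<Longrightarrow> T s" "K s \<Longrightarrow> \<exists>u v. split_pair s u v \<and> K u \<and> K v" for s
    using perfect_kernel[of T split_pair] unfolding K_def perfect_def by blast+
  have down: "K r" if "K s" "prefix (list_decode r) (list_decode s)" for r s
  proof -
    \<comment> \<open>The closure of the kernel under prefixes is again perfect, since a pair that
      splits a node also splits all its prefixes.\<close>
    define J where "J r \<longleftrightarrow> (\<exists>s. K s \<and> prefix (list_decode r) (list_decode s))" for r
    have "K u \<Longrightarrow> J u" for u
      unfolding J_def by blast
    moreover have "split_pair r u v" if "split_pair s u v" "prefix (list_decode r) (list_decode s)" for r s u v
      using that unfolding split_pair_def using prefix_order.trans by blast
    ultimately have "perfect T split_pair J"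
      unfolding perfect_def J_def using perf tree_downward[of Q z] T_def by metis
    moreover have "J r"
      using that unfolding J_def by blast
    ultimately show ?thesis
      unfolding K_def by (rule perfect_imp_kernel)
  qed
  define S where "S = {\<sigma>. K (list_encode \<sigma>)}"
  have f: "\<exists>f. \<forall>s. K s \<longrightarrow> (\<exists>u v. split_pair s u v \<and> K u \<and> K v \<and> u \<le> f s \<and> v \<le> f s)"
  proof (intro choice allI)
    fix s
    show "\<exists>m. K s \<longrightarrow> (\<exists>u v. split_pair s u v \<and> K u \<and> K v \<and> u \<le> m \<and> v \<le> m)"
    proof (cases "K s")
      case True
      then obtain u v where "split_pair s u v" "K u" "K v"
        using perf(2) by blast
      then show ?thesis
        by (intro exI[of _ "max u v"] impI exI[of _ u] exI[of _ v]) auto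
    qed simp
  qed
  then obtain f where f: "\<And>s. K s \<Longrightarrow> \<exists>u v. split_pair s u v \<and> K u \<and> K v \<and> u \<le> f s \<and> v \<le> f s"
    by blast
  \<comment> \<open>With the maximum over all codes up to \<open>n\<close>, the second of any two
    marks from \<open>s\<close> on is at least \<open>f s\<close>, the bound for a splitting of
    \<open>s\<close>.\<close>
  define F where "F n = Max (f ` {..n})" for n
  have F: "f s \<le> F n" if "s \<le> n" for s n
    unfolding F_def using that by (intro Max_ge) auto
  obtain h mk br where S: "\<And>n. pre h n \<in> S"
    and mk: "\<And>n. mk n \<longleftrightarrow> (\<exists>j<h n. pre h n @ [j] \<in> S)"
    and br: "\<And>n. br n \<longleftrightarrow> (\<exists>j. j \<noteq> h n \<and> pre h n @ [j] \<in> S)"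
    and inf: "\<And>n. \<exists>m\<ge>n. mk m" and gap: "\<And>m n. m < n \<Longrightarrow> mk m \<Longrightarrow> mk n \<Longrightarrow> F m \<le> n"
    and code: "\<And>n. mk n \<Longrightarrow> b (card {m. m < n \<and> mk m}) \<longleftrightarrow> even (card {m. m < n \<and> br m})"
  proof (rule coding_path[of S F b])
    show "[] \<in> S"
      using down[of s0 "list_encode []"] ker unfolding S_def K_def T_def by simp
    show "\<sigma> \<in> S" if "prefix \<sigma> \<tau>" "\<tau> \<in> S" for \<sigma> \<tau>
      using down[of "list_encode \<tau>" "list_encode \<sigma>"] that unfolding S_def by simp
    show "\<exists>u v. u \<in> S \<and> v \<in> S \<and> prefix \<sigma> u \<and> prefix \<sigma> v \<and> \<not> prefix u v \<and> \<not> prefix v u"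
      if \<sigma>: "\<sigma> \<in> S" for \<sigma>
    proof -
      obtain u v where "split_pair (list_encode \<sigma>) u v" "K u" "K v"
        using perf(2) \<sigma> unfolding S_def by blast
      then show ?thesis
        unfolding S_def split_pair_def
        by (intro exI[of _ "list_decode u"] exI[of _ "list_decode v"]) simp
    qed
  qed blast
  have S_iff: "\<sigma> \<in> S \<longleftrightarrow> (\<exists>\<rho>. \<sigma> = list_decode \<rho> \<and> K \<rho>)" for \<sigma>
    unfolding S_def by (metis list_decode_inverse list_encode_inverse mem_Collect_eq)
  have mark_iff: "(\<exists>w \<rho>. prefix_set h w \<and> length (list_decode w) = Suc n \<and>
      R (list_decode \<rho>) (list_decode w) \<and> K \<rho>) \<longleftrightarrow> (\<exists>\<rho>\<in>S. R \<rho> (pre h (Suc n)))" for n R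
  proof -
    have "(\<exists>w \<rho>. prefix_set h w \<and> length (list_decode w) = Suc n \<and>
      R (list_decode \<rho>) (list_decode w) \<and> K \<rho>) \<longleftrightarrow>
      (\<exists>w. list_decode w = pre h (Suc n) \<and> (\<exists>\<rho>. R (list_decode \<rho>) (list_decode w) \<and> K \<rho>))"
      unfolding prefix_set_length[symmetric] by blast
    also have "\<dots> \<longleftrightarrow> (\<exists>\<rho>. R (list_decode \<rho>) (pre h (Suc n)) \<and> K \<rho>)"
      by (metis list_encode_inverse)
    finally show ?thesis
      unfolding Bex_def S_iff by blast
  qed
  have br_eq: "(\<exists>w \<rho>. prefix_set h w \<and> length (list_decode w) = Suc n \<and>
      (left_sibling (list_decode \<rho>) (list_decode w) \<or> left_sibling (list_decode w) (list_decode \<rho>)) \<and>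
      K \<rho>) \<longleftrightarrow> br n" for n
    unfolding mark_iff[where R = "\<lambda>\<rho> \<sigma>. left_sibling \<rho> \<sigma> \<or> left_sibling \<sigma> \<rho>"] br left_sibling_pre
    by (metis linorder_neq_iff)
  have mark: "mark h K n \<longleftrightarrow> mk n" for n
    unfolding mark_def mark_iff mk left_sibling_pre by blast
  have bd: "within_marks h K s u" if "u \<le> f s" for s u
    unfolding within_marks_def mark
  proof
    assume "\<exists>m n. s \<le> m \<and> m < n \<and> n < u \<and> mk m \<and> mk n"
    then obtain m n where "s \<le> m" "m < n" "n < u" "mk m" "mk n" by blast
    then show False
      using gap[of m n] F[of s m] that by linarith
  qed
  show thesis
  proof (rule that[of h])
    show "tree Q z (list_encode (pre h n))" for n
      using S[of n] perf(1) unfolding S_def T_def by blast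
    fix v assume hyps: "hyp (oracle_of Q) v" "hyp (tree Q z) v" "hyp (prefix_set h) v"
    have "hyp K v"
      unfolding K_def
    proof (rule hyp_kernel[OF hyps(1) _ hyps(3)])
      show "hyp T v" using hyps(2) by (simp add: T_def)
      show "\<exists>m\<ge>n. mark h (kernel T split_pair) m" for n
        using inf mark unfolding K_def by blast
      show "\<exists>u v. split_pair s u v \<and> kernel T split_pair u \<and> kernel T split_pair v \<and>
        within_marks h (kernel T split_pair) s u \<and> within_marks h (kernel T split_pair) s v"
        if "kernel T split_pair s" for s
        using f[of s] bd that unfolding K_def by blast
    qed
    then have mb: "hyp mk v" "hyp br v"
      using hyp_marks_branchings[OF hyps(1) _ hyps(3), of K] unfolding mark[abs_def] br_eq by blast+
    \<comment> \<open>Bit \<open>i\<close> is read at the mark preceded by exactly \<open>i\<close>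
      marks; the sum of variable 2 with itself expresses that the number of branchings is
      even.\<close>
    define \<phi> where "\<phi> = FEx 1 (FEx 2 (FAnd (FMem (NVar 1) 2) (FAnd (FMem (npr (NVar 1) (NVar 0)) 3)
      (FMem (npr (NVar 1) (NAdd (NVar 2) (NVar 2))) 4))))"
    show "hyp b v"
    proof (rule hyp_comprehension[OF mb(1) hyp_count[OF mb(1)] hyp_count[OF mb(2)] mb(1), where \<phi> = \<phi>])
      show "closed_fm (FAll 0 (FIff (FMem (NVar 0) 0) \<phi>))"
        by (simp add: closed_fm_def \<phi>_def)
      fix e X b' i
      have "arith_sat (e(0 := i)) (env6 b' X mk (\<lambda>k. \<exists>n i. k = pr n i \<and> card {m. m < n \<and> mk m} = i)
        (\<lambda>k. \<exists>n i. k = pr n i \<and> card {m. m < n \<and> br m} = i) mk) \<phi> \<longleftrightarrow>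
        (\<exists>n j. mk n \<and> card {m. m < n \<and> mk m} = i \<and> card {m. m < n \<and> br m} = j + j)"
        by (simp add: \<phi>_def) metis
      also have "\<dots> \<longleftrightarrow> (\<exists>n. mk n \<and> card {m. m < n \<and> mk m} = i \<and> even (card {m. m < n \<and> br m}))"
        unfolding dvd_def mult_2 by blast
      also have "\<dots> \<longleftrightarrow> b i"
        using code exists_nth_mark[of mk i, OF inf] by blast
      finally show "arith_sat (e(0 := i)) (env6 b' X mk (\<lambda>k. \<exists>n i. k = pr n i \<and> card {m. m < n \<and> mk m} = i)
        (\<lambda>k. \<exists>n i. k = pr n i \<and> card {m. m < n \<and> br m} = i) mk) \<phi> \<longleftrightarrow> b i" .
    qed
  qed
qed

section \<open>From a path in the graph to the coding point\<close>

theorem theorem5p9: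
  fixes E :: "(cantor \<times> cantor) set"
  assumes "equiv UNIV E"
    and "analytic_set E"
    and "\<And>x. uncountable (E `` {x})"
    and "borel_graphable E"
  shows "weak_borel_pair_coding E"
proof -
  obtain G where "G \<in> sets borel" and GE: "G\<^sup>* = E"
    using assms(4) unfolding borel_graphable_def borel_graph_def by blast
  obtain Q :: "bool list \<Rightarrow> nat list \<Rightarrow> bool"
    where G: "\<And>z y. (z, y) \<in> G \<longleftrightarrow> (\<exists>\<beta>. (\<forall>n. Q (pre z n) (pre \<beta> n)) \<and> y = (\<lambda>i. odd (\<beta> i)))"
    and uniq: "\<And>z \<beta> \<beta>'. (\<forall>n. Q (pre z n) (pre \<beta> n)) \<Longrightarrow> (\<forall>n. Q (pre z n) (pre \<beta>' n)) \<Longrightarrow>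
       (\<And>i. odd (\<beta> i) = odd (\<beta>' i)) \<Longrightarrow> \<beta> = \<beta>'"
    by (fact borel_branches[OF \<open>G \<in> sets borel\<close>])
  have branch: "(\<forall>n. tree Q z (list_encode (pre \<beta> n))) \<longleftrightarrow> (\<forall>n. Q (pre z n) (pre \<beta> n))" for z \<beta>
  proof
    assume "\<forall>n. tree Q z (list_encode (pre \<beta> n))"
    then show "\<forall>n. Q (pre z n) (pre \<beta> n)"
      unfolding tree_def by fastforce
  next
    assume *: "\<forall>n. Q (pre z n) (pre \<beta> n)"
    have "\<sigma> = pre \<beta> (length \<sigma>)" if "prefix \<sigma> (pre \<beta> n)" for \<sigma> n
    proof (rule nth_equalityI)
      fix i assume "i < length \<sigma>"
      then show "\<sigma> ! i = pre \<beta> (length \<sigma>) ! i"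
        using that prefix_length_le[OF that] by (auto simp: prefix_def nth_append dest!: arg_cong[of _ _ "\<lambda>l. l ! i"])
    qed simp
    then have "Q (pre z (length \<sigma>)) \<sigma>" if "prefix \<sigma> (pre \<beta> n)" for \<sigma> n
      using * that by metis
    then show "\<forall>n. tree Q z (list_encode (pre \<beta> n))"
      unfolding tree_def list_encode_inverse by blast
  qed
  define a where "a = oracle_of Q"
  show ?thesis
    unfolding weak_borel_pair_coding_def
  proof (rule exI[of _ a], intro allI)
    fix x b :: cantor
    have "\<not> E `` {x} \<subseteq> {y. hyp y (x \<oplus> a)}"
      using assms(3)[of x] countable_hyp countable_subset by blast
    then obtain y0 where "(x, y0) \<in> G\<^sup>*" "\<not> hyp y0 (x \<oplus> a)"
      using GE by blast
    \<comment> \<open>Some edge of the path leaves the points hyperarithmetic in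
      \<open>x \<oplus> a\<close>; the empty path is impossible because \<open>x\<close> is such a
      point.\<close>
    then have "\<exists>z y. (x, z) \<in> G\<^sup>* \<and> (z, y) \<in> G \<and> hyp z (x \<oplus> a) \<and> \<not> hyp y (x \<oplus> a)"
    proof (induction rule: rtrancl_induct)
      case base
      then show ?case using hyp_join_left by blast
    next
      case (step y z)
      then show ?case by blast
    qed
    then obtain z y where xz: "(x, z) \<in> E" and zy: "(z, y) \<in> G" and z: "hyp z (x \<oplus> a)"
      and y: "\<not> hyp y (x \<oplus> a)"
      using GE by blast
    \<comment> \<open>Otherwise every neighbour of \<open>z\<close>, in particular \<open>y\<close>,
      would be hyperarithmetic in \<open>x \<oplus> a\<close>.\<close>
    have "\<exists>s. kernel (tree Q z) split_pair s"
    proof (rule ccontr)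
      assume no: "\<nexists>s. kernel (tree Q z) split_pair s"
      obtain \<beta> where \<beta>: "\<forall>n. Q (pre z n) (pre \<beta> n)" "y = (\<lambda>i. odd (\<beta> i))"
        using zy G by blast
      have "hyp (oracle_of Q) (x \<oplus> a)"
        using hyp_join_right[of a x] by (simp add: a_def)
      moreover have "tree Q z (list_encode (pre \<beta> n))" for n
        using \<beta>(1) branch by blast
      ultimately have "hyp y (x \<oplus> a)"
        unfolding \<beta>(2) using no z
        by (intro hyp_branch_if_no_kernel[where T = "tree Q z" and Q = Q]) (auto intro: hyp_tree)
      then show False using y by blast
    qed
    then obtain s where ker: "kernel (tree Q z) split_pair s"
      by blast
    obtain h where h: "\<And>n. tree Q z (list_encode (pre h n))"
      and code: "\<And>v. hyp (oracle_of Q) v \<Longrightarrow> hyp (tree Q z) v \<Longrightarrow> hyp (prefix_set h) v \<Longrightarrow> hyp b v"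
      by (fact kernel_codes[OF ker])
    define y' where "y' i = odd (h i)" for i
    have Qh: "\<forall>n. Q (pre z n) (pre h n)"
      using h branch by blast
    then have "(z, y') \<in> G"
      unfolding G y'_def[abs_def] by blast
    then have "(x, y') \<in> E"
      using xz GE by (metis rtrancl.rtrancl_into_rtrancl)
    define v where "v = x \<oplus> y' \<oplus> a"
    have a: "hyp a v"
      unfolding v_def by (rule hyp_join_right)
    have "hyp (x \<oplus> y') v"
      unfolding v_def by (rule hyp_join_left)
    then have x: "hyp x v" and y': "hyp y' v"
      using hyp_trans hyp_join_left hyp_join_right by blast+
    \<comment> \<open>\<open>z\<close> is not one of the joined sets; it is recovered from
      \<open>x\<close> and \<open>a\<close>.\<close>
    have "hyp z v"
      using hyp_trans[OF z hyp_join[OF x a]] .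
    then have T: "hyp (tree Q z) v"
      using a unfolding a_def by (intro hyp_tree)
    have "hyp (prefix_set h) v"
    proof (rule hyp_prefix_set[OF a[unfolded a_def] T _ h])
      show "hyp (\<lambda>i. odd (h i)) v"
        using y' by (simp add: y'_def[abs_def])
      show "\<gamma> = h" if "\<And>n. tree Q z (list_encode (pre \<gamma> n))" "\<And>i. odd (\<gamma> i) = odd (h i)" for \<gamma>
        using uniq[of z \<gamma> h] that branch Qh by blast
    qed
    then have "hyp b v"
      using code a T unfolding a_def by blast
    then show "\<exists>y. (x, y) \<in> E \<and> b \<le>\<^sub>h x \<oplus> y \<oplus> a"
      using \<open>(x, y') \<in> E\<close> hyp_imp_hyp_le unfolding v_def by blast
  qed
qed

end
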